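(* Let $a,b,c,d\in\mathbb{C}$ and let $\mathcal{L}_{\mathrm{W}}$ be the associated Wilson–Sturm–Liouville operator. Let $\phi$ be an entire function of order $\sigma_\phi>0$. Then any non-trivial (i.e. not identically zero) meromorphic solution $f$ on $\mathbb{C}$ of the equation $\mathcal{L}_{\mathrm{W}}(y)=\phi y$ must have order $\sigma\ge\sigma_\phi+\frac12$.
   Context: The Wilson operator $\mathcal{D}_{\mathrm{W}}$: for $x\ne0$ and $z$ with $z^2=x$, $$(\mathcal{D}_{\mathrm{W}}f)(x):=\frac{f((z+\frac i2)^2)-f((z-\frac i2)^2)}{2iz},$$ which does not depend on the choice of $z$; at $x=0$ the value is the limit as $x\to0$, which is $f'(-\frac14)$ if $f$ is differentiable at $-\frac14$. If $f$ is meromorphic on $\mathbb{C}$, so is $\mathcal{D}_{\mathrm{W}}f$. For $a,b,c,d\in\mathbb{C}$ and $x=z^2$ put $$\mu(x;a,b,c,d):=\frac{\prod_{e\in(a,b,c,d)}\Gamma(e-iz)\Gamma(e+iz)}{\Gamma(2iz)\Gamma(-2iz)}$$ (product over the four entries of the tuple $(a,b,c,d)$), which is even in $z$ and hence a meromorphic function of $x$. The Wilson–Sturm–Liouville operator is $$(\mathcal{L}_{\mathrm{W}}f)(x):=\frac1{\mu(x;a,b,c,d)}\,\mathcal{D}_{\mathrm{W}}\Big(\mu\big(\cdot;a+\tfrac12,b+\tfrac12,c+\tfrac12,d+\tfrac12\big)\,\mathcal{D}_{\mathrm{W}}f\Big)(x).$$ The order of a meromorphic $f$ is $\limsup_{r\to\infty}\frac{\ln^+T(r,f)}{\ln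 r}\in[0,+\infty]$, with $T$ the Nevanlinna characteristic. *)

theory Defs
  imports "HOL-Complex_Analysis.Complex_Analysis"
begin

text \<open>
  A meromorphic function is represented by any \<open>f\<close> with \<open>f meromorphic_on UNIV\<close>; its values at
  poles and on a discrete closed set are immaterial. Accordingly, two meromorphic functions are
  identified if they agree on a cosparse set, written \<open>\<forall>\<^sub>\<approx>x\<in>UNIV. f x = g x\<close>.
  The Nevanlinna functions below do not depend on the representative.
\<close>

subsection \<open>Nevanlinna characteristic and order\<close>

definition ln_plus :: "real \<Rightarrow> real" where
  "ln_plus x = ln (max 1 x)"

definition nev_n :: "real \<Rightarrow> (complex \<Rightarrow> complex) \<Rightarrow> real" where
  "nev_n t f = (\<Sum>z\<in>{z\<in>cball 0 t. is_pole f z}. real_of_int (- zorder f z))"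

text \<open>The integrand of \<open>nev_N\<close> vanishes for small \<open>t\<close>.\<close>

definition nev_N :: "real \<Rightarrow> (complex \<Rightarrow> complex) \<Rightarrow> real" where
  "nev_N r f = integral {0..r} (\<lambda>t. (nev_n t f - nev_n 0 f) / t) + nev_n 0 f * ln r"

definition nev_m :: "real \<Rightarrow> (complex \<Rightarrow> complex) \<Rightarrow> real" where
  "nev_m r f = integral {0..2*pi} (\<lambda>\<theta>. ln_plus (norm (f (of_real r * cis \<theta>)))) / (2 * pi)"

definition nev_T :: "real \<Rightarrow> (complex \<Rightarrow> complex) \<Rightarrow> real" where
  "nev_T r f = nev_m r f + nev_N r f"

definition mero_order :: "(complex \<Rightarrow> complex) \<Rightarrow> ereal" where
  "mero_order f = Limsup at_top (\<lambda>r::real. ereal (ln_plus (nev_T r f) / ln r))"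

subsection \<open>The Wilson operator\<close>

definition wilson_quot :: "(complex \<Rightarrow> complex) \<Rightarrow> complex \<Rightarrow> complex" where
  "wilson_quot f z = (f ((z + \<i>/2)\<^sup>2) - f ((z - \<i>/2)\<^sup>2)) / (2 * \<i> * z)"

definition wilson_D :: "(complex \<Rightarrow> complex) \<Rightarrow> complex \<Rightarrow> complex" where
  "wilson_D f x = (if x \<noteq> 0 then wilson_quot f (csqrt x)
                   else Lim (at 0) (\<lambda>x. wilson_quot f (csqrt x)))"

lemma wilson_quot_minus: "wilson_quot f (- z) = wilson_quot f z"
proof -
  have "(- z + \<i>/2)\<^sup>2 = (z - \<i>/2)\<^sup>2" "(- z - \<i>/2)\<^sup>2 = (z + \<i>/2)\<^sup>2"
    by (simp_all add: power2_eq_square algebra_simps)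
  then show ?thesis
    by (simp add: wilson_quot_def minus_divide_left)
qed

text \<open>The choice of the square root in \<open>wilson_D\<close> is irrelevant.\<close>

lemma wilson_D_eq:
  assumes "x \<noteq> 0" "z\<^sup>2 = x"
  shows "wilson_D f x = wilson_quot f z"
proof -
  have "z = csqrt x \<or> z = - csqrt x"
    using assms by (metis power2_csqrt power2_eq_iff)
  then show ?thesis
    using assms(1) wilson_quot_minus[of f "csqrt x"] by (auto simp: wilson_D_def)
qed

lemma wilson_D_0:
  assumes "(f has_field_derivative D) (at (-1/4))"
  shows "wilson_D f 0 = D"
proof -
  define g where "g = (\<lambda>z. f ((z + \<i>/2)\<^sup>2))"
  define h where "h = (\<lambda>z. g z - g (- z))"
  have D: "(f has_field_derivative D) (at ((0 + \<i>/2)\<^sup>2))"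
    using assms by (simp add: power2_eq_square)
  have g: "(g has_field_derivative D * \<i>) (at 0)"
    unfolding g_def
    by (rule DERIV_chain2[where f = f and g = "\<lambda>z. (z + \<i>/2)\<^sup>2", OF D]) (auto intro!: derivative_eq_intros)
  then have g': "(g has_field_derivative D * \<i>) (at (- 0))"
    by simp
  have "(h has_field_derivative D * \<i> - D * \<i> * (- 1)) (at 0)"
    unfolding h_def
    by (intro DERIV_diff g DERIV_chain2[where f = g and g = uminus, OF g']) (auto intro!: derivative_eq_intros)
  then have "((\<lambda>z. h z / z) \<longlongrightarrow> 2 * \<i> * D) (at 0)"
    by (simp add: has_field_derivative_iff h_def algebra_simps)
  then have "((\<lambda>z. h z / z / (2 * \<i>)) \<longlongrightarrow> 2 * \<i> * D / (2 * \<i>)) (at 0)"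
    by (intro tendsto_intros) auto
  moreover have "h z / z / (2 * \<i>) = wilson_quot f z" for z
  proof -
    have "(- z + \<i>/2)\<^sup>2 = (z - \<i>/2)\<^sup>2"
      by (simp add: power2_eq_square algebra_simps)
    then show ?thesis
      by (simp add: h_def g_def wilson_quot_def mult.commute)
  qed
  ultimately have lim: "(wilson_quot f \<longlongrightarrow> D) (at 0)"
    by simp
  have "continuous (at 0) csqrt"
    unfolding continuous_at_eps_delta dist_norm
  proof safe
    fix e :: real assume "e > 0"
    then show "\<exists>d>0. \<forall>x'. norm (x' - 0) < d \<longrightarrow> norm (csqrt x' - csqrt 0) < e"
      by (intro exI[of _ "e\<^sup>2"]) (auto simp: norm_csqrt intro!: real_less_lsqrt)
  qed
  then have "filterlim csqrt (at 0) (at 0)"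
    by (auto simp: filterlim_at isCont_def eventually_at_filter)
  then have "((\<lambda>x. wilson_quot f (csqrt x)) \<longlongrightarrow> D) (at 0)"
    by (rule filterlim_compose[OF lim])
  then show ?thesis
    by (simp add: wilson_D_def tendsto_Lim)
qed

subsection \<open>The Wilson weight and the Wilson--Sturm--Liouville operator\<close>

text \<open>
  As \<open>Gamma\<close> is \<open>0\<close> at its poles, \<open>wilson_\<mu>\<close> agrees with the meromorphic weight only off a
  discrete closed set.
\<close>

definition wilson_\<mu>_root :: "complex \<Rightarrow> complex \<Rightarrow> complex \<Rightarrow> complex \<Rightarrow> complex \<Rightarrow> complex" where
  "wilson_\<mu>_root a b c d z =
     (\<Prod>e\<leftarrow>[a, b, c, d]. Gamma (e - \<i> * z) * Gamma (e + \<i> * z)) /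
     (Gamma (2 * \<i> * z) * Gamma (- 2 * \<i> * z))"

definition wilson_\<mu> :: "complex \<Rightarrow> complex \<Rightarrow> complex \<Rightarrow> complex \<Rightarrow> complex \<Rightarrow> complex" where
  "wilson_\<mu> a b c d x = wilson_\<mu>_root a b c d (csqrt x)"

lemma wilson_\<mu>_eq:
  assumes "z\<^sup>2 = x"
  shows "wilson_\<mu> a b c d x = wilson_\<mu>_root a b c d z"
proof -
  have "wilson_\<mu>_root a b c d (- w) = wilson_\<mu>_root a b c d w" for w
    by (simp add: wilson_\<mu>_root_def mult_ac)
  moreover have "z = csqrt x \<or> z = - csqrt x"
    using assms by (metis power2_csqrt power2_eq_iff)
  ultimately show ?thesis
    unfolding wilson_\<mu>_def by metis
qed

definition wilson_L ::
    "complex \<Rightarrow> complex \<Rightarrow> complex \<Rightarrow> complex \<Rightarrow> (complex \<Rightarrow> complex) \<Rightarrow> complex \<Rightarrow> complex" where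
  "wilson_L a b c d f x =
     1 / wilson_\<mu> a b c d x *
     wilson_D (\<lambda>t. wilson_\<mu> (a + 1/2) (b + 1/2) (c + 1/2) (d + 1/2) t * wilson_D f t) x"

end

theory Submission
  imports Defs "HOL-Real_Asymp.Real_Asymp"
begin

text \<open>
  In the variable \<open>z\<close> with \<open>x = z\<^sup>2\<close>, the eigenvalue equation expresses \<open>\<phi> (z\<^sup>2)\<close> as a combination of the
  quotients \<open>f ((z \<plusminus> \<i>)\<^sup>2) / f (z\<^sup>2)\<close> with rational coefficients. The step from \<open>z\<^sup>2\<close> to \<open>(z \<plusminus> \<i>)\<^sup>2\<close> has
  length about \<open>2 * sqrt \<bar>x\<bar>\<close>, so, if \<open>nev_T r f \<le> r powr s\<close> for large \<open>r\<close>, the Poisson--Jensen formula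
  bounds the logarithms of the quotients by about \<open>\<bar>x\<bar> powr (s - 1/2)\<close>, up to logarithmic factors,
  wherever \<open>z\<close> is not too close to the square root of a zero or pole of \<open>f\<close>. An averaging argument finds a
  square of half-side between \<open>\<rho>\<close> and \<open>2 * \<rho>\<close> whose boundary stays away from these points, also
  after shifts by \<open>\<plusminus> \<i>\<close>. Since \<open>\<phi>\<close> is entire, the maximum principle carries the bound from the boundary
  to the disc of radius \<open>\<rho>\<close>. Hence \<open>\<phi>\<close> has order at most \<open>max 0 (s - 1/2)\<close>.
\<close>

subsection \<open>Poisson--Jensen formula\<close>

text \<open>The gain of 1/2 has two sources. For \<open>norm z\<close> about \<rho>, the points z^2
  and (z + \<i>)^2 lie at distance about \<rho> in a disc of radius about \<rho>^2, so their Poisson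
  kernels differ by about 1/\<rho>. The logarithmic singularities at zeros and poles have no
  pointwise bound, but their integral over the half-sides from \<rho> to 2 * \<rho> is only about ln
  \<rho>, so their mean is about ln \<rho> / \<rho>. Both are weighted by a total of size
  \<rho>^(2s) * ln \<rho>, which yields \<rho>^(2s - 1) * (ln \<rho>)^2. A square replaces the usual
  circle because its sides, and their translates by \<i>, are parallel to the axes, so that
  averaging takes place in one real variable. A single shift suffices: the square is symmetric under
  negation and (z - \<i>)^2 = (- z + \<i>)^2. The rational coefficients cost a multiple of ln
  \<rho>. This is why the resulting order is at most max 0 (s - 1/2) and where positivity of the
  order of \<phi> enters.\<close>

definition poisson_kernel :: "real \<Rightarrow> complex \<Rightarrow> real \<Rightarrow> real" where
  "poisson_kernel R x \<theta> = Re ((of_real R * cis \<theta> + x) / (of_real R * cis \<theta> - x))"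

lemma circle_minus_nz: "norm x < R \<Longrightarrow> of_real R * cis \<theta> - x \<noteq> 0"
  by (auto simp: norm_mult)

lemma poisson_kernel_altdef:
  assumes "norm x < R"
  shows "poisson_kernel R x \<theta> = (R\<^sup>2 - (norm x)\<^sup>2) / (norm (of_real R * cis \<theta> - x))\<^sup>2"
proof -
  define w where "w = of_real R * cis \<theta>"
  have w: "(Re w)\<^sup>2 + (Im w)\<^sup>2 = R\<^sup>2"
    unfolding w_def by (simp add: power_mult_distrib flip: distrib_left)
  have "poisson_kernel R x \<theta> = ((Re w)\<^sup>2 + (Im w)\<^sup>2 - (Re x)\<^sup>2 - (Im x)\<^sup>2) / (norm (w - x))\<^sup>2"
    unfolding poisson_kernel_def w_def[symmetric] Re_divide' Re_complex_div_eq_0 cmod_power2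
    by (simp add: Re_divide power2_eq_square algebra_simps diff_divide_distrib add_divide_distrib)
  also have "(Re w)\<^sup>2 + (Im w)\<^sup>2 - (Re x)\<^sup>2 - (Im x)\<^sup>2 = R\<^sup>2 - (norm x)\<^sup>2"
    using w by (simp add: cmod_power2)
  finally show ?thesis by (simp add: w_def)
qed

text \<open>Harnack's bounds: the kernel lies between \<open>(R - norm x) / (R + norm x)\<close> and
  its reciprocal, which are 1/3 and 3 at \<open>norm x = R / 2\<close>.\<close>

lemma poisson_kernel_bounds:
  assumes "norm x \<le> R / 2" "R > 0"
  shows "1/3 \<le> poisson_kernel R x \<theta>" "poisson_kernel R x \<theta> \<le> 3"
proof -
  define n where "n = norm (of_real R * cis \<theta> - x)"
  have x: "norm x < R" using assms by linarith
  have n: "R - norm x \<le> n" "n \<le> R + norm x"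
    unfolding n_def using norm_triangle_ineq2[of "of_real R * cis \<theta>" x]
      norm_triangle_ineq4[of "of_real R * cis \<theta>" x] assms(2) by (auto simp: norm_mult)
  have n0: "n > 0" using n x by linarith
  have "n\<^sup>2 \<le> (R + norm x)\<^sup>2" "(R - norm x)\<^sup>2 \<le> n\<^sup>2"
    using n n0 x by (intro power_mono; simp)+
  moreover have "(R + norm x) * (R + norm x) \<le> (R + norm x) * (3 * (R - norm x))"
    "(R - norm x) * (R + norm x) \<le> (R - norm x) * (3 * (R - norm x))"
    using assms x by (intro mult_left_mono; simp add: add_nonneg_nonneg)+
  ultimately have "n\<^sup>2 \<le> 3 * (R\<^sup>2 - (norm x)\<^sup>2)" "R\<^sup>2 - (norm x)\<^sup>2 \<le> 3 * n\<^sup>2"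
    by (simp_all add: power2_eq_square algebra_simps)
  then show "1/3 \<le> poisson_kernel R x \<theta>" "poisson_kernel R x \<theta> \<le> 3"
    unfolding poisson_kernel_altdef[OF x] n_def[symmetric] using n0 by (simp_all add: field_simps)
qed

text \<open>With \<open>w\<close> on the circle, the underlying analytic kernels differ by
  \<open>2 * w * (x - y) / ((w - x) * (w - y))\<close>, and both denominators are at least 3/4 * R
  in modulus. Closeness of \<open>x\<close> and \<open>y\<close> thus becomes a small factor in
  front of the boundary values.\<close>

lemma poisson_kernel_diff:
  assumes "norm x \<le> R / 4" "norm y \<le> R / 4" "R > 0"
  shows "\<bar>poisson_kernel R x \<theta> - poisson_kernel R y \<theta>\<bar> \<le> 4 * norm (x - y) / R"
proof -
  define w where "w = of_real R * cis \<theta>"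
  have nw: "norm w = R" using assms by (simp add: w_def norm_mult)
  have n: "norm (w - x) \<ge> 3/4 * R" "norm (w - y) \<ge> 3/4 * R"
    using norm_triangle_ineq2[of w x] norm_triangle_ineq2[of w y] assms nw by linarith+
  have nz: "w - x \<noteq> 0" "w - y \<noteq> 0" using n assms by auto
  have "(w + x) / (w - x) - (w + y) / (w - y) = 2 * w * (x - y) / ((w - x) * (w - y))"
    using nz by (simp add: divide_simps) (simp add: algebra_simps)
  then have "norm ((w + x) / (w - x) - (w + y) / (w - y))
      = 2 * R * norm (x - y) / (norm (w - x) * norm (w - y))"
    by (simp add: norm_divide norm_mult nw)
  also have "\<dots> \<le> 2 * R * norm (x - y) / ((3/4 * R) * (3/4 * R))"
    using n assms nz by (intro divide_left_mono mult_mono mult_pos_pos) auto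
  also have "\<dots> = (32/9) * (norm (x - y) / R)" using assms by (simp add: field_simps)
  also have "\<dots> \<le> 4 * (norm (x - y) / R)" using assms by (intro mult_right_mono) auto
  finally have *: "norm ((w + x) / (w - x) - (w + y) / (w - y)) \<le> 4 * norm (x - y) / R" by simp
  show ?thesis
    unfolding poisson_kernel_def w_def[symmetric]
    using abs_Re_le_cmod[of "(w + x) / (w - x) - (w + y) / (w - y)"] * by simp
qed

text \<open>
  The Poisson kernel arises by adding to the Cauchy kernel its reflection in the circle, which
  integrates to zero.
\<close>

lemma poisson_formula:
  assumes "continuous_on (cball 0 R) h" "h holomorphic_on ball 0 R" "norm x < R"
  shows "((\<lambda>\<theta>. poisson_kernel R x \<theta> * Re (h (of_real R * cis \<theta>))) has_integral 2 * pi * Re (h x))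
    {0..2*pi}"
proof -
  have R: "R > 0" using assms(3) norm_ge_zero[of x] by linarith
  \<comment> \<open>The zero of \<open>q\<close> is the mirror image of \<open>x\<close> in the
    circle, hence outside the closed disc.\<close>
  define q where "q = (\<lambda>u. (of_real R)\<^sup>2 - cnj x * u)"
  have qnz: "q u \<noteq> 0" if "norm u \<le> R" for u
  proof
    assume "q u = 0"
    then have "norm ((of_real R)\<^sup>2 :: complex) = norm (cnj x * u)" by (simp add: q_def)
    then have "R * R = norm x * norm u" by (simp add: norm_mult norm_power power2_eq_square)
    also have "\<dots> \<le> norm x * R" using that by (intro mult_left_mono) auto
    also have "\<dots> < R * R" using assms(3) R by simp
    finally show False by simp
  qed
  \<comment> \<open>\<open>k u / (u - x)\<close> is \<open>h u\<close> times the reflected kernel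
    \<open>cnj x / q u\<close>. The factor \<open>u - x\<close> brings it into the form of Cauchy's
    formula, with value \<open>k x = 0\<close>.\<close>
  define k where "k = (\<lambda>u. h u * (u - x) * cnj x / q u)"
  have 1: "((\<lambda>u. h u / (u - x)) has_contour_integral 2 * of_real pi * \<i> * h x) (circlepath 0 R)"
    using assms by (intro Cauchy_integral_circlepath) auto
  have 2: "((\<lambda>u. k u / (u - x)) has_contour_integral 2 * of_real pi * \<i> * k x) (circlepath 0 R)"
    using assms qnz unfolding k_def q_def
    by (intro Cauchy_integral_circlepath)
       (auto intro!: continuous_intros holomorphic_intros)
  have "((\<lambda>u. h u / (u - x) + k u / (u - x)) has_contour_integral 2 * of_real pi * \<i> * h x)
          (part_circlepath 0 R 0 (2*pi))"
    using has_contour_integral_add[OF 1 2] by (simp add: circlepath_def k_def)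
  then have "((\<lambda>t. (h (0 + of_real R * cis t) / (0 + of_real R * cis t - x)
         + k (0 + of_real R * cis t) / (0 + of_real R * cis t - x)) * of_real R * \<i> * cis t)
       has_integral 2 * of_real pi * \<i> * h x) {0..2*pi}"
    by (subst (asm) has_contour_integral_part_circlepath_iff) auto
  then have "((\<lambda>t. (- \<i>) * ((h (0 + of_real R * cis t) / (0 + of_real R * cis t - x)
         + k (0 + of_real R * cis t) / (0 + of_real R * cis t - x)) * of_real R * \<i> * cis t))
       has_integral (- \<i>) * (2 * of_real pi * \<i> * h x)) {0..2*pi}"
    by (rule has_integral_mult_right)
  moreover have "(- \<i>) * ((h (0 + of_real R * cis t) / (0 + of_real R * cis t - x)
         + k (0 + of_real R * cis t) / (0 + of_real R * cis t - x)) * of_real R * \<i> * cis t)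
       = of_real (poisson_kernel R x t) * h (of_real R * cis t)" for t
  proof -
    define w where "w = of_real R * cis t"
    have nw: "norm w = R" using R by (simp add: w_def norm_mult)
    have ww: "(of_real R)\<^sup>2 = w * cnj w" using nw by (simp add: complex_norm_square[symmetric])
    have nz: "w - x \<noteq> 0" using circle_minus_nz[OF assms(3), of t] by (simp add: w_def)
    have w0: "w \<noteq> 0" using nw R by auto
    have cnz: "cnj w - cnj x \<noteq> 0" using nz by (metis complex_cnj_diff complex_cnj_zero_iff)
    have qw: "q w = w * (cnj w - cnj x)" by (simp add: q_def ww algebra_simps)
    have "of_real (poisson_kernel R x t) = ((w + x) / (w - x) + cnj ((w + x) / (w - x))) / 2"
      unfolding poisson_kernel_def w_def[symmetric] complex_add_cnj by simp
    also have "\<dots> = w / (w - x) + cnj x / (cnj w - cnj x)"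
      using nz cnz by (simp add: divide_simps) (simp add: algebra_simps)
    finally have pk: "of_real (poisson_kernel R x t) = w / (w - x) + cnj x / (cnj w - cnj x)" .
    have "k w / (w - x) * w = h w * (cnj x / (cnj w - cnj x))"
      unfolding k_def qw using nz cnz w0 by (simp add: divide_simps)
    then have "(h w / (w - x) + k w / (w - x)) * w = of_real (poisson_kernel R x t) * h w"
      unfolding pk by (simp add: algebra_simps)
    then show ?thesis by (simp add: w_def algebra_simps)
  qed
  ultimately have "((\<lambda>t. of_real (poisson_kernel R x t) * h (of_real R * cis t))
       has_integral (- \<i>) * (2 * of_real pi * \<i> * h x)) {0..2*pi}"
    by (simp only:)
  from has_integral_linear[OF this bounded_linear_Re] show ?thesis
    by (simp add: o_def)
qed

lemma ln_power_int: "x > 0 \<Longrightarrow> ln (x powi k) = of_int k * ln (x::real)"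
  by (simp add: ln_powr flip: powr_real_of_int')

text \<open>For \<open>norm a < R\<close> this has modulus 1 on the circle of radius
  \<open>R\<close> and a single simple zero in the disc, at \<open>a\<close>. Dividing by such
  factors does not change the modulus on the circle.\<close>

definition blaschke :: "real \<Rightarrow> complex \<Rightarrow> complex \<Rightarrow> complex" where
  "blaschke R a x = of_real R * (x - a) / ((of_real R)\<^sup>2 - cnj a * x)"

section \<open>Local orders, factorization and the Poisson-Jensen formula for a meromorphic
  function\<close>

locale nontrivial_meromorphic =
  fixes f :: "complex \<Rightarrow> complex"
  assumes mero: "f meromorphic_on UNIV"
    and nonzero: "\<forall>\<^sub>\<approx>x\<in>UNIV. f x \<noteq> 0"
begin

text \<open>Also contains the removable singularities at which \<open>f\<close> has an arbitrary value; \<open>zorder f\<close> is \<open>0\<close> there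
  unless the limit is \<open>0\<close>.\<close>

definition bad :: "complex set" where
  "bad = {x. \<not> (f analytic_on {x} \<and> f x \<noteq> 0)}"

lemma sparse_bad: "bad sparse_in UNIV"
proof -
  have "\<forall>\<^sub>\<approx>x\<in>UNIV. f analytic_on {x} \<and> f x \<noteq> 0"
    using meromorphic_on_imp_analytic_cosparse[OF mero] nonzero by (rule eventually_conj)
  then show ?thesis unfolding eventually_cosparse bad_def .
qed

lemma finite_bad: "compact K \<Longrightarrow> finite (bad \<inter> K)"
  using sparse_in_compact_finite[OF sparse_in_subset[OF sparse_bad]] by (simp add: Int_commute)

lemma countable_bad: "countable bad"
  using sparse_imp_countable[OF _ sparse_bad] by simp

lemma eventually_nonzero_at: "eventually (\<lambda>x. f x \<noteq> 0) (at p)"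
  using nonzero by (simp add: eventually_cosparse_open_eq)

lemma zorder_not_bad:
  assumes "p \<notin> bad" shows "zorder f p = 0"
  using assms by (intro zorder_eq_0I) (auto simp: bad_def)

lemma pole_bad: "is_pole f p \<Longrightarrow> p \<in> bad"
  unfolding bad_def using analytic_at_imp_no_pole by auto

lemma zorder_neg_pole: "zorder f p < 0 \<Longrightarrow> is_pole f p"
  by (rule zorder_neg_imp_is_pole[OF _ eventually_nonzero_at])
     (auto intro: meromorphic_on_subset[OF mero])

text \<open>Treats zeros, poles, regular points and removable singularities alike, independently of
  the value \<open>f p\<close>.\<close>

lemma zor_limit:
  shows "\<exists>c. c \<noteq> 0 \<and> ((\<lambda>x. f x * (x - p) powi (- zorder f p)) \<longlongrightarrow> c) (at p)"
proof -
  have m: "isolated_singularity_at f p" "not_essential f p"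
    using mero by (auto simp: meromorphic_on_altdef)
  have fr: "\<exists>\<^sub>Fw in at p. f w \<noteq> 0"
    using eventually_nonzero_at by (intro eventually_frequently) auto
  from zorder_exist[OF m fr] obtain r where r: "zor_poly f p p \<noteq> 0" "r > 0"
    "zor_poly f p holomorphic_on cball p r"
    "\<And>w. w \<in> cball p r - {p} \<Longrightarrow> f w = zor_poly f p w * (w - p) powi zorder f p" by blast
  have "isCont (zor_poly f p) p"
    using r(2) by (intro continuous_on_interior[OF holomorphic_on_imp_continuous_on[OF r(3)]]) auto
  then have "(zor_poly f p \<longlongrightarrow> zor_poly f p p) (at p)" by (simp add: isCont_def)
  moreover have "\<forall>\<^sub>F x in at p. zor_poly f p x = f x * (x - p) powi (- zorder f p)"
    unfolding eventually_at
  proof (intro exI[of _ r] conjI ballI impI r(2))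
    fix x assume x: "x \<noteq> p \<and> dist x p < r"
    then have "f x = zor_poly f p x * (x - p) powi zorder f p"
      by (intro r(4)) (auto simp: dist_commute)
    then show "zor_poly f p x = f x * (x - p) powi (- zorder f p)"
      using x by (simp add: power_int_minus field_simps)
  qed
  ultimately have "((\<lambda>x. f x * (x - p) powi (- zorder f p)) \<longlongrightarrow> zor_poly f p p) (at p)"
    by (rule Lim_transform_eventually)
  then show ?thesis using r(1) by blast
qed

text \<open>Once the factors are divided out, \<open>zor_limit\<close> makes every point of
  \<open>U\<close> a removable singularity with nonzero limit, and \<open>remove_sings\<close> fills
  in the values. The equation is claimed off \<open>bad\<close> only, since the values of
  \<open>f\<close> there are arbitrary.\<close>

lemma factorization:
  assumes fin: "finite (bad \<inter> U)" and U: "open U"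
  obtains g where "g holomorphic_on U" "\<And>x. x \<in> U \<Longrightarrow> g x \<noteq> 0"
    "\<And>x. x \<in> U - bad \<Longrightarrow> f x = g x * (\<Prod>a\<in>bad \<inter> U. (x - a) powi zorder f a)"
proof -
  define S where "S = bad \<inter> U"
  define G where "G = (\<lambda>x. f x * (\<Prod>a\<in>S. (x - a) powi (- zorder f a)))"
  have fS: "finite S" using fin by (simp add: S_def)
  have mG: "G meromorphic_on UNIV"
    unfolding G_def by (intro meromorphic_intros mero)
  have lim: "\<exists>c. c \<noteq> 0 \<and> (G \<longlongrightarrow> c) (at p)" if p: "p \<in> U" for p
  proof -
    obtain c where c: "c \<noteq> 0" "((\<lambda>x. f x * (x - p) powi (- zorder f p)) \<longlongrightarrow> c) (at p)"
      using zor_limit by blast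
    \<comment> \<open>The factor at \<open>p\<close> may be split off even for \<open>p\<close>
      outside \<open>S\<close>, because its exponent is then 0.\<close>
    have "(\<Prod>a\<in>S. (x - a) powi (- zorder f a)) =
        (x - p) powi (- zorder f p) * (\<Prod>a\<in>S - {p}. (x - a) powi (- zorder f a))" for x
    proof (cases "p \<in> S")
      case True then show ?thesis using fS by (simp add: prod.remove)
    next
      case False
      then have "zorder f p = 0" using p zorder_not_bad by (auto simp: S_def)
      then show ?thesis using False by simp
    qed
    then have G: "G = (\<lambda>x. f x * (x - p) powi (- zorder f p) *
        (\<Prod>a\<in>S - {p}. (x - a) powi (- zorder f a)))"
      by (simp add: G_def mult.assoc)
    have "(G \<longlongrightarrow> c * (\<Prod>a\<in>S - {p}. (p - a) powi (- zorder f a))) (at p)"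
      unfolding G by (intro tendsto_intros c) auto
    moreover have "(\<Prod>a\<in>S - {p}. (p - a) powi (- zorder f a)) \<noteq> 0"
      using fS by auto
    ultimately show ?thesis using c(1) by (intro exI[of _ "c * _"]) auto
  qed
  show ?thesis
  proof (rule that)
    have "remove_sings G analytic_on {p}" if "p \<in> U" for p
      using lim[OF that] mG by (auto simp: meromorphic_on_altdef intro: remove_sings_analytic_at)
    then have "remove_sings G analytic_on U" by (subst analytic_on_analytic_at) auto
    then show "remove_sings G holomorphic_on U" using analytic_imp_holomorphic by blast
    show "remove_sings G x \<noteq> 0" if "x \<in> U" for x
      using lim[OF that] remove_sings_eqI by metis
    show "f x = remove_sings G x * (\<Prod>a\<in>bad \<inter> U. (x - a) powi zorder f a)" if x: "x \<in> U - bad" for x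
    proof -
      have xS: "x \<notin> S" using x by (auto simp: S_def)
      have "f analytic_on {x}" using x by (auto simp: bad_def)
      then have "G analytic_on {x}"
        unfolding G_def using xS by (intro analytic_intros) auto
      then have "remove_sings G x = G x" by simp
      moreover have "(\<Prod>a\<in>S. (x - a) powi (- zorder f a)) * (\<Prod>a\<in>S. (x - a) powi zorder f a) = 1"
        unfolding prod.distrib[symmetric] using xS
        by (intro prod.neutral) (auto simp: power_int_minus intro!: left_inverse)
      ultimately show ?thesis by (simp add: G_def S_def[symmetric] mult.assoc)
    qed
  qed
qed

text \<open>Zeros and poles in the disc prevent \<open>f\<close> from having a holomorphic
  logarithm. Replacing each factor \<open>x - a\<close> by \<open>q a x\<close>, of equal modulus on
  the circle but without zeros in the disc, produces a function with logarithm \<open>h\<close>. The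
  discrepancy inside is a product of powers of Blaschke factors, and \<open>poisson_formula\<close>
  applies to \<open>h\<close>.\<close>

lemma poisson_jensen:
  assumes R: "R > 0" and sph: "sphere 0 R \<inter> bad = {}" and x: "norm x < R" "x \<notin> bad"
  shows "((\<lambda>\<theta>. poisson_kernel R x \<theta> * ln (norm (f (of_real R * cis \<theta>)))) has_integral
      2 * pi * (ln (norm (f x)) - (\<Sum>a\<in>bad \<inter> ball 0 R. of_int (zorder f a) * ln (norm (blaschke R a x)))))
    {0..2*pi}"
proof -
  define N where "N = norm ` (bad \<inter> cball 0 (R + 1)) \<inter> {R<..}"
  have finN: "finite N" using finite_bad[of "cball 0 (R + 1)"] by (simp add: N_def)
  \<comment> \<open>The larger disc contains no further bad points, so the factorization extends
    past the circle and \<open>h\<close> is continuous up to it.\<close>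
  define R' where "R' = Min (insert (R + 1) N)"
  have R': "R < R'" unfolding R'_def using finN by (subst Min_gr_iff) (auto simp: N_def)
  have ball': "bad \<inter> ball 0 R' = bad \<inter> ball 0 R"
  proof (intro set_eqI iffI)
    fix a assume a: "a \<in> bad \<inter> ball 0 R'"
    then have "norm a < Min (insert (R + 1) N)" by (simp add: R'_def)
    then have n: "norm a < R + 1" "norm a \<notin> N"
      using finN by (auto simp del: Min_insert)
    then have "norm a \<le> R" using a by (auto simp: N_def)
    moreover have "norm a \<noteq> R" using a sph by auto
    ultimately show "a \<in> bad \<inter> ball 0 R" using a by auto
  qed (use R' in auto)
  define S where "S = bad \<inter> ball 0 R"
  have fS: "finite S" unfolding S_def
    by (rule finite_subset[OF _ finite_bad[of "cball 0 R"]]) auto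
  obtain g where g: "g holomorphic_on ball 0 R'" "\<And>x. x \<in> ball 0 R' \<Longrightarrow> g x \<noteq> 0"
    "\<And>x. x \<in> ball 0 R' - bad \<Longrightarrow> f x = g x * (\<Prod>a\<in>S. (x - a) powi zorder f a)"
    using factorization[of "ball 0 R'"] fS unfolding ball' S_def by auto
  obtain h0 where h0: "h0 holomorphic_on ball 0 R'" "\<And>x. x \<in> ball 0 R' \<Longrightarrow> exp (h0 x) = g x"
    using holomorphic_logarithm_exists[OF _ _ g(1) g(2), of 0] R R' by auto
  define q where "q = (\<lambda>a x. of_real R - cnj a * x / of_real R)"
  \<comment> \<open>\<open>q a x\<close> is \<open>R\<close> minus a number of modulus less than
    \<open>R\<close>, so the principal branch of \<open>Ln\<close> can be used.\<close>
  have q: "Re (q a x) > 0" if "a \<in> S" "norm x \<le> R" for a x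
  proof -
    have "norm (cnj a * x / of_real R) = norm a * norm x / R" using R by (simp add: norm_mult norm_divide)
    also have "\<dots> \<le> norm a * R / R" using R that by (intro divide_right_mono mult_left_mono) auto
    also have "\<dots> < R" using that R by (auto simp: S_def)
    finally show ?thesis
      using complex_Re_le_cmod[of "cnj a * x / of_real R"] by (simp add: q_def)
  qed
  then have qnn: "q a x \<notin> \<real>\<^sub>\<le>\<^sub>0" if "a \<in> S" "norm x \<le> R" for a x
    using that complex_nonpos_Reals_iff by force
  define h where "h = (\<lambda>x. h0 x + (\<Sum>a\<in>S. of_int (zorder f a) * Ln (q a x)))"
  have sub: "cball 0 R \<subseteq> ball 0 R'" using R' by auto
  have contq: "continuous_on A (q a)" for a A unfolding q_def using R by (intro continuous_intros) auto
  have holq: "q a holomorphic_on A" for a A unfolding q_def using R by (intro holomorphic_intros) auto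
  have cont: "continuous_on (cball 0 R) h"
    unfolding h_def using qnn
    by (intro continuous_intros contq continuous_on_subset[OF holomorphic_on_imp_continuous_on[OF h0(1)] sub])
      (auto simp: q_def)
  have hol: "h holomorphic_on ball 0 R"
    unfolding h_def using qnn sub
    by (intro holomorphic_intros holq holomorphic_on_subset[OF h0(1)]) (auto simp: q_def)
  have Reh: "Re (h y) = ln (norm (f y)) - (\<Sum>a\<in>S. of_int (zorder f a) * ln (norm (blaschke R a y)))"
    if y: "norm y \<le> R" "y \<notin> bad" for y
  proof -
    have yb: "y \<in> ball 0 R'" using y R' by auto
    have yS: "y - a \<noteq> 0" if "a \<in> S" for a using that y by (auto simp: S_def)
    have Re0: "Re (h0 y) = ln (norm (g y))"
      using h0(2)[OF yb] by (metis ln_exp norm_exp_eq_Re)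
    have "norm (f y) = norm (g y) * (\<Prod>a\<in>S. norm (y - a) powi zorder f a)"
      using g(3)[of y] yb y by (simp add: norm_mult norm_power_int flip: prod_norm)
    moreover have "ln (\<Prod>a\<in>S. norm (y - a) powi zorder f a)
        = (\<Sum>a\<in>S. of_int (zorder f a) * ln (norm (y - a)))"
      using yS fS by (subst ln_prod) (auto simp: ln_power_int intro!: sum.cong)
    ultimately have lnf: "ln (norm (f y)) = ln (norm (g y)) + (\<Sum>a\<in>S. of_int (zorder f a) * ln (norm (y - a)))"
      using g(2)[OF yb] yS fS by (simp add: ln_mult prod_pos)
    have bl: "ln (norm (blaschke R a y)) = ln (norm (y - a)) - ln (norm (q a y))" if "a \<in> S" for a
    proof -
      have qn: "q a y \<noteq> 0" using q[OF that y(1)] by auto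
      have "blaschke R a y = (y - a) / q a y"
        unfolding blaschke_def q_def using R by (simp add: divide_simps power2_eq_square)
      then show ?thesis using yS[OF that] qn by (simp add: norm_divide ln_div)
    qed
    have "q a y \<noteq> 0" if "a \<in> S" for a using q[OF that y(1)] by auto
    then have "Re (h y) = ln (norm (g y)) + (\<Sum>a\<in>S. of_int (zorder f a) * ln (norm (q a y)))"
      unfolding h_def by (simp add: Re0 cong: sum.cong)
    also have "\<dots> = ln (norm (f y)) - (\<Sum>a\<in>S. of_int (zorder f a) * ln (norm (blaschke R a y)))"
      unfolding lnf by (simp add: bl sum_subtractf right_diff_distrib cong: sum.cong)
    finally show ?thesis .
  qed
  have circ: "Re (h (of_real R * cis t)) = ln (norm (f (of_real R * cis t)))" for t
  proof -
    define w where "w = of_real R * cis t"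
    have nw: "norm w = R" using R by (simp add: w_def norm_mult)
    have wb: "w \<notin> bad" using nw sph by auto
    have "norm (blaschke R a w) = 1" if "a \<in> S" for a
    proof -
      have ww: "(of_real R)\<^sup>2 = w * cnj w" using nw by (simp add: complex_norm_square[symmetric])
      have wa: "w - a \<noteq> 0" using that wb by (auto simp: S_def)
      have "(of_real R)\<^sup>2 - cnj a * w = w * cnj (w - a)" by (simp add: ww algebra_simps)
      then have "norm (blaschke R a w) = R * norm (w - a) / (norm w * norm (w - a))"
        unfolding blaschke_def using R by (simp add: norm_mult norm_divide del: complex_cnj_diff)
      then show ?thesis using wa R nw by simp
    qed
    then show ?thesis using Reh[of w] nw wb by (simp add: w_def)
  qed
  show ?thesis
    using poisson_formula[OF cont hol x(1)] Reh[of x] x by (simp add: circ S_def)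
qed

end

subsection \<open>Growth of zeros and of the logarithm\<close>

lemma blaschke_norm:
  assumes a: "norm a < R" and x: "norm x < R"
  shows "norm (blaschke R a x) \<le> 1"
proof -
  have R: "R > 0" using a norm_ge_zero[of a] by linarith
  have "(norm (of_real (R\<^sup>2) - cnj a * x))\<^sup>2 - (R * norm (x - a))\<^sup>2
      = (R\<^sup>2 - (norm a)\<^sup>2) * (R\<^sup>2 - (norm x)\<^sup>2)"
    unfolding power_mult_distrib cmod_power2 by (simp add: power2_eq_square algebra_simps)
  moreover have "(norm a)\<^sup>2 \<le> R\<^sup>2" "(norm x)\<^sup>2 \<le> R\<^sup>2" using a x by (intro power_mono; simp)+
  ultimately have "(R * norm (x - a))\<^sup>2 \<le> (norm (of_real (R\<^sup>2) - cnj a * x))\<^sup>2"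
    using mult_nonneg_nonneg[of "R\<^sup>2 - (norm a)\<^sup>2" "R\<^sup>2 - (norm x)\<^sup>2"] by linarith
  then have "R * norm (x - a) \<le> norm (of_real (R\<^sup>2) - cnj a * x)"
    by (rule power2_le_imp_le) simp
  then show ?thesis
    unfolding blaschke_def using R by (simp add: norm_mult norm_divide divide_le_eq)
qed

lemma blaschke_denom_bounds:
  assumes "norm a < R"
  shows "R\<^sup>2 - R * norm x \<le> norm ((of_real R)\<^sup>2 - cnj a * x)"
    "norm ((of_real R)\<^sup>2 - cnj a * x) \<le> R\<^sup>2 + R * norm x"
proof -
  have "norm a * norm x \<le> R * norm x" using assms by (intro mult_right_mono) auto
  then show "R\<^sup>2 - R * norm x \<le> norm ((of_real R)\<^sup>2 - cnj a * x)"
    "norm ((of_real R)\<^sup>2 - cnj a * x) \<le> R\<^sup>2 + R * norm x"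
    using norm_triangle_ineq2[of "(of_real R)\<^sup>2" "cnj a * x"]
      norm_triangle_ineq4[of "(of_real R)\<^sup>2" "cnj a * x"]
    by (simp_all add: norm_mult norm_power)
qed

text \<open>The constant is (5/8) / (15/16). It gives every zero in the half disc a fixed
  contribution of ln (3/2) to Jensen's formula, so that zeros can be counted.\<close>

lemma blaschke_norm_two_thirds:
  assumes a: "norm a \<le> R / 2" and x: "norm x \<le> R / 8" and R: "R > 0"
  shows "norm (blaschke R a x) \<le> 2/3"
proof -
  have "norm a * norm x \<le> (R/2) * (R/8)" using a x R by (intro mult_mono) auto
  then have d: "norm ((of_real R)\<^sup>2 - cnj a * x) \<ge> 15/16 * R\<^sup>2"
    using norm_triangle_ineq2[of "(of_real R)\<^sup>2" "cnj a * x"]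
    by (simp add: norm_mult norm_power power2_eq_square)
  have "norm (x - a) \<le> 5/8 * R" using norm_triangle_ineq4[of x a] a x by linarith
  then have "R * norm (x - a) \<le> R * (5/8 * R)" using R by (intro mult_left_mono) auto
  also have "\<dots> = 2/3 * (15/16 * R\<^sup>2)" by (simp add: power2_eq_square)
  also have "\<dots> \<le> 2/3 * norm ((of_real R)\<^sup>2 - cnj a * x)" using d by simp
  finally have *: "R * norm (x - a) \<le> 2/3 * norm ((of_real R)\<^sup>2 - cnj a * x)" .
  have "0 < 15/16 * R\<^sup>2" using R by simp
  then have "norm ((of_real R)\<^sup>2 - cnj a * x) > 0" using d by linarith
  then show ?thesis
    using * R unfolding blaschke_def by (simp add: norm_mult norm_divide divide_simps mult_ac)
qed

text \<open>The denominator is at most 2 * R^2. This caps the contribution of a pole at distance at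
  least \<open>d\<close>.\<close>

lemma blaschke_norm_lower:
  assumes a: "norm a < R" and x: "norm x < R" and d: "d \<le> norm (x - a)" "0 < d"
  shows "d / (2 * R) \<le> norm (blaschke R a x)"
proof -
  have R: "R > 0" using a norm_ge_zero[of a] by linarith
  define D where "D = norm ((of_real R)\<^sup>2 - cnj a * x)"
  have "R * norm x < R * R" using x R by simp
  then have D: "0 < D" "D \<le> 2 * R\<^sup>2"
    using blaschke_denom_bounds[OF a, of x] by (auto simp: D_def power2_eq_square)
  have "d * D \<le> norm (x - a) * (2 * R\<^sup>2)" using d D by (intro mult_mono) auto
  then have "d / (2 * R) \<le> R * norm (x - a) / D"
    using D R by (simp add: field_simps power2_eq_square)
  then show ?thesis
    unfolding blaschke_def D_def using R by (simp add: norm_mult norm_divide)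
qed

lemma ln_plus_eq: "x > 0 \<Longrightarrow> ln_plus x = max 0 (ln x)"
  by (auto simp: ln_plus_def max_def)

lemma nev_m_nonneg: "nev_m r f \<ge> 0"
proof -
  \<comment> \<open>Without integrability the integral has the default value 0.\<close>
  have "integral {0..2*pi} (\<lambda>\<theta>. ln_plus (norm (f (of_real r * cis \<theta>)))) \<ge> 0"
  proof (cases "(\<lambda>\<theta>. ln_plus (norm (f (of_real r * cis \<theta>)))) integrable_on {0..2*pi}")
    case True then show ?thesis by (intro integral_nonneg) (auto simp: ln_plus_def)
  qed (simp add: not_integrable_integral)
  then show ?thesis by (simp add: nev_m_def)
qed

lemma ln_three_halves: "ln (3/2 :: real) \<ge> 1/3"
  using ln_le_minus_one[of "2/3 :: real"] by (simp add: ln_div)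

lemma ln_ge_1: "(x::real) \<ge> 3 \<Longrightarrow> ln x \<ge> 1"
  using exp_le by (subst ln_ge_iff) auto

section \<open>Counting functions and bounds in terms of the characteristic\<close>

context nontrivial_meromorphic
begin

definition poles :: "real \<Rightarrow> complex set" where
  "poles r = {z \<in> cball 0 r. is_pole f z}"

lemma finite_poles: "finite (poles r)"
  by (rule finite_subset[OF _ finite_bad[of "cball 0 r"]]) (auto simp: poles_def pole_bad)

lemma zorder_pole: "is_pole f z \<Longrightarrow> zorder f z < 0"
  using isolated_pole_imp_neg_zorder mero by (auto simp: meromorphic_on_altdef)

lemma nev_n_altdef: "nev_n t f = (\<Sum>a\<in>poles t. of_int (- zorder f a))"
  by (simp add: nev_n_def poles_def)

lemma nev_n_nonneg: "nev_n t f \<ge> 0"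
  unfolding nev_n_altdef using zorder_pole by (intro sum_nonneg) (force simp: poles_def)

text \<open>Sum and integral are exchanged: a pole \<open>a\<close> off the origin contributes its
  multiplicity times the integral of 1/t from \<open>norm a\<close> to \<open>r\<close>.\<close>

lemma nev_N_eq:
  assumes r: "r > 0"
  shows "nev_N r f = (\<Sum>a\<in>poles r - {0}. of_int (- zorder f a) * (ln r - ln (norm a))) + nev_n 0 f * ln r"
proof -
  have "((\<lambda>t. (nev_n t f - nev_n 0 f) / t) has_integral
      (\<Sum>a\<in>poles r - {0}. of_int (- zorder f a) * (ln r - ln (norm a)))) {0..r}"
  proof (rule has_integral_eq)
    show "((\<lambda>t. \<Sum>a\<in>poles r - {0}. of_int (- zorder f a) * (if t \<in> {norm a..r} then 1 / t else 0)) has_integral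
       (\<Sum>a\<in>poles r - {0}. of_int (- zorder f a) * (ln r - ln (norm a)))) {0..r}"
    proof (intro has_integral_sum has_integral_mult_right)
      fix a assume a: "a \<in> poles r - {0}"
      then have "0 < norm a" "norm a \<le> r" by (auto simp: poles_def)
      then have "((\<lambda>t. 1 / t) has_integral (ln r - ln (norm a))) {norm a..r}"
        by (intro fundamental_theorem_of_calculus)
          (auto simp: has_real_derivative_iff_has_vector_derivative[symmetric] simp del: zero_less_norm_iff
            intro!: derivative_eq_intros)
      then show "((\<lambda>t. if t \<in> {norm a..r} then 1 / t else 0) has_integral (ln r - ln (norm a))) {0..r}"
        by (subst has_integral_restrict) auto
    qed (use finite_poles in auto)
    fix t assume t: "t \<in> {0..r}"
    have "nev_n t f = (\<Sum>a\<in>poles r. if norm a \<le> t then of_int (- zorder f a) else 0)"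
      unfolding nev_n_altdef using t finite_poles
      by (intro sum.mono_neutral_cong_left) (auto simp: poles_def)
    moreover have "nev_n 0 f = (\<Sum>a\<in>poles r. if a = 0 then of_int (- zorder f a) else 0)"
      unfolding nev_n_altdef using r finite_poles
      by (intro sum.mono_neutral_cong_left) (auto simp: poles_def)
    moreover have "(\<Sum>a\<in>poles r. if a = 0 then of_int (- zorder f a) else 0)
        + (\<Sum>a\<in>poles r - {0}. if norm a \<le> t then of_int (- zorder f a) else 0)
        = (\<Sum>a\<in>poles r. if norm a \<le> t then of_int (- zorder f a) else (0::real))"
      using finite_poles t by (cases "0 \<in> poles r") (auto simp: sum.remove intro!: sum.neutral sum.cong)
    ultimately have eq: "nev_n t f - nev_n 0 f
        = (\<Sum>a\<in>poles r - {0}. if norm a \<le> t then of_int (- zorder f a) else 0)" by linarith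
    show "(\<Sum>a\<in>poles r - {0}. of_int (- zorder f a) * (if t \<in> {norm a..r} then 1 / t else 0))
        = (nev_n t f - nev_n 0 f) / t"
      unfolding eq sum_divide_distrib using t by (intro sum.cong refl) auto
  qed
  then show ?thesis by (simp add: nev_N_def integral_unique)
qed

text \<open>In the disc of radius 2 * r a pole of modulus at most \<open>r\<close> has weight ln (2
  * r / norm a), at least ln 2. For a pole at the origin the weight is ln (2 * r), whence
  \<open>r \<ge> 1\<close>.\<close>

lemma nev_N_ge:
  assumes r: "r \<ge> 1"
  shows "nev_N (2 * r) f \<ge> nev_n r f * ln 2"
proof -
  have "(\<Sum>a\<in>poles r - {0}. of_int (- zorder f a) * ln 2)
      \<le> (\<Sum>a\<in>poles r - {0}. of_int (- zorder f a) * (ln (2*r) - ln (norm a)))"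
  proof (intro sum_mono mult_left_mono)
    fix a assume a: "a \<in> poles r - {0}"
    then have "ln (norm a) \<le> ln r" using r by (auto simp: poles_def)
    then show "ln 2 \<le> ln (2*r) - ln (norm a)" using r by (simp add: ln_mult)
    show "0 \<le> real_of_int (- zorder f a)" using a zorder_pole[of a] by (simp add: poles_def)
  qed
  also have "\<dots> \<le> (\<Sum>a\<in>poles (2 * r) - {0}. of_int (- zorder f a) * (ln (2*r) - ln (norm a)))"
  proof (intro sum_mono2)
    fix a assume a: "a \<in> poles (2 * r) - {0} - (poles r - {0})"
    then have "ln (norm a) \<le> ln (2 * r)" using r by (auto simp: poles_def)
    moreover have "0 \<le> real_of_int (- zorder f a)" using a zorder_pole[of a] by (simp add: poles_def)
    ultimately show "0 \<le> real_of_int (- zorder f a) * (ln (2*r) - ln (norm a))"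
      by (intro mult_nonneg_nonneg) auto
  qed (use finite_poles r in \<open>auto simp: poles_def\<close>)
  finally have 1: "(\<Sum>a\<in>poles r - {0}. of_int (- zorder f a)) * ln 2
      \<le> (\<Sum>a\<in>poles (2 * r) - {0}. of_int (- zorder f a) * (ln (2*r) - ln (norm a)))"
    by (simp only: sum_distrib_right)
  have "ln 2 \<le> ln (2 * r)" using r by simp
  then have 2: "nev_n 0 f * ln 2 \<le> nev_n 0 f * ln (2 * r)"
    using nev_n_nonneg by (intro mult_left_mono)
  have "poles 0 = poles r \<inter> {0}" using r by (auto simp: poles_def)
  then have "nev_n r f = (\<Sum>a\<in>poles r - {0}. of_int (- zorder f a)) + nev_n 0 f"
    unfolding nev_n_altdef using finite_poles[of r] by (subst sum.Int_Diff[of _ _ "{0}"]) auto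
  then show ?thesis using 1 2 r by (subst nev_N_eq) (auto simp: algebra_simps)
qed

lemma sum_neg_zorder_le:
  assumes "A \<subseteq> cball 0 r" "A \<subseteq> bad"
  shows "(\<Sum>a\<in>A. max 0 (- real_of_int (zorder f a))) \<le> nev_n r f"
proof -
  have fA: "finite A" using finite_subset[OF _ finite_bad[of "cball 0 r"]] assms by auto
  have "(\<Sum>a\<in>A. max 0 (- real_of_int (zorder f a))) = (\<Sum>a\<in>A \<inter> poles r. of_int (- zorder f a))"
  proof (intro sum.mono_neutral_cong_right fA)
    show "\<forall>a\<in>A - A \<inter> poles r. max 0 (- real_of_int (zorder f a)) = 0"
    proof
      fix a assume "a \<in> A - A \<inter> poles r"
      then have "\<not> zorder f a < 0" using assms zorder_neg_pole[of a] by (auto simp: poles_def)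
      then show "max 0 (- real_of_int (zorder f a)) = 0" by simp
    qed
    show "max 0 (- real_of_int (zorder f a)) = of_int (- zorder f a)" if "a \<in> A \<inter> poles r" for a
      using that zorder_pole[of a] by (auto simp: poles_def max_def)
  qed auto
  also have "\<dots> \<le> nev_n r f"
    unfolding nev_n_altdef using finite_poles zorder_pole
    by (intro sum_mono2) (force simp: poles_def)+
  finally show ?thesis .
qed

lemma generic_radius:
  assumes "0 \<le> u" "u < v"
  obtains R where "u < R" "R < v" "sphere 0 R \<inter> bad = {}"
proof -
  have "infinite ({u<..<v} - norm ` (bad \<inter> cball 0 v))"
    using finite_bad[of "cball 0 v"] assms by (intro Diff_infinite_finite) auto
  then obtain R where "R \<in> {u<..<v} - norm ` (bad \<inter> cball 0 v)"
    using infinite_imp_nonempty by blast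
  then show ?thesis by (intro that[of R]) auto
qed

lemma continuous_on_ln_circle:
  assumes R: "R > 0" and sph: "sphere 0 R \<inter> bad = {}"
  shows "continuous_on A (\<lambda>\<theta>. ln (norm (f (of_real R * cis \<theta>))))"
proof -
  have sp: "of_real R * cis \<theta> \<notin> bad" for \<theta>
    using sph R by (force simp: norm_mult)
  have "f analytic_on sphere 0 R"
    using sph by (subst analytic_on_analytic_at) (auto simp: bad_def)
  then have "continuous_on (sphere 0 R) f"
    by (intro holomorphic_on_imp_continuous_on analytic_imp_holomorphic)
  then have "continuous_on A (\<lambda>\<theta>. f (of_real R * cis \<theta>))"
    by (rule continuous_on_compose2) (use R in \<open>auto intro!: continuous_intros simp: norm_mult\<close>)
  then show ?thesis using sp by (auto intro!: continuous_intros simp: bad_def)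
qed

lemma nev_m_generic:
  assumes R: "R > 0" and sph: "sphere 0 R \<inter> bad = {}"
  shows "((\<lambda>\<theta>. max 0 (ln (norm (f (of_real R * cis \<theta>))))) has_integral 2 * pi * nev_m R f) {0..2*pi}"
proof -
  have sp: "of_real R * cis \<theta> \<notin> bad" for \<theta>
    using sph R by (force simp: norm_mult)
  have "(\<lambda>\<theta>. ln_plus (norm (f (of_real R * cis \<theta>)))) = (\<lambda>\<theta>. max 0 (ln (norm (f (of_real R * cis \<theta>)))))"
    using sp by (auto simp: ln_plus_eq bad_def)
  then have "2 * pi * nev_m R f = integral {0..2*pi} (\<lambda>\<theta>. max 0 (ln (norm (f (of_real R * cis \<theta>)))))"
    by (simp add: nev_m_def)
  then show ?thesis
    using continuous_on_ln_circle[OF assms]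
    by (simp only:) (intro integrable_integral integrable_continuous_real continuous_on_max continuous_on_const)
qed

text \<open>
  Evaluating the Poisson--Jensen formula at a regular point \<open>z0\<close> instead of the origin avoids a special
  treatment of a zero or pole at the origin, at the cost of the factors \<open>1/3\<close> and \<open>3\<close> from the kernel.
\<close>

lemma first_main_bound:
  assumes z0: "z0 \<notin> bad" "norm z0 \<le> R / 8" and R: "R > 0" and sph: "sphere 0 R \<inter> bad = {}"
    and d: "0 < d" "d \<le> R" "bad \<inter> ball z0 d = {}"
  defines "Q \<equiv> 3 * nev_m R f + nev_n R f * ln (2 * R / d) - ln (norm (f z0))"
  shows "(\<Sum>a\<in>bad \<inter> cball 0 (R/2). max 0 (real_of_int (zorder f a))) \<le> 3 * Q" (is ?A)
    and "integral {0..2*pi} (\<lambda>\<theta>. \<bar>ln (norm (f (of_real R * cis \<theta>)))\<bar>) \<le> 2 * pi * (nev_m R f + 3 * Q)" (is ?B)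
proof -
  define L where "L = (\<lambda>\<theta>. ln (norm (f (of_real R * cis \<theta>))))"
  define K where "K = poisson_kernel R z0"
  define S where "S = bad \<inter> ball 0 R"
  define Z where "Z = (\<Sum>a\<in>bad \<inter> cball 0 (R/2). max 0 (real_of_int (zorder f a)))"
  define I where "I = integral {0..2*pi} (\<lambda>\<theta>. max 0 (- L \<theta>))"
  have fS: "finite S" unfolding S_def
    by (rule finite_subset[OF _ finite_bad[of "cball 0 R"]]) auto
  have contL: "continuous_on {0..2*pi} L" unfolding L_def by (rule continuous_on_ln_circle[OF R sph])
  have z0R: "norm z0 < R" using z0 R by linarith
  have Kb: "1/3 \<le> K \<theta>" "K \<theta> \<le> 3" for \<theta>
    unfolding K_def using poisson_kernel_bounds[of z0 R \<theta>] z0 R by auto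
  have I: "((\<lambda>\<theta>. max 0 (- L \<theta>)) has_integral I) {0..2*pi}"
    unfolding I_def using contL
    by (intro integrable_integral integrable_continuous_real continuous_intros continuous_on_max)
  have I0: "I \<ge> 0" using I by (rule has_integral_nonneg) auto
  have M: "((\<lambda>\<theta>. max 0 (L \<theta>)) has_integral 2 * pi * nev_m R f) {0..2*pi}"
    unfolding L_def by (rule nev_m_generic[OF R sph])
  have PJ: "((\<lambda>\<theta>. K \<theta> * L \<theta>) has_integral
      2 * pi * (ln (norm (f z0)) - (\<Sum>a\<in>S. of_int (zorder f a) * ln (norm (blaschke R a z0))))) {0..2*pi}"
    unfolding K_def L_def S_def using poisson_jensen[OF R sph z0R z0(1)] .
  \<comment> \<open>The kernel is replaced by its upper bound 3 where \<open>L\<close> is positive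
    and by its lower bound 1/3 where \<open>L\<close> is negative.\<close>
  have "((\<lambda>\<theta>. 3 * max 0 (L \<theta>) - 1/3 * max 0 (- L \<theta>)) has_integral
      3 * (2 * pi * nev_m R f) - 1/3 * I) {0..2*pi}"
    by (intro has_integral_diff has_integral_mult_right M I)
  from PJ this have 1: "2 * pi * (ln (norm (f z0)) - (\<Sum>a\<in>S. of_int (zorder f a) * ln (norm (blaschke R a z0))))
      \<le> 3 * (2 * pi * nev_m R f) - 1/3 * I"
  proof (rule has_integral_le)
    fix \<theta>
    show "K \<theta> * L \<theta> \<le> 3 * max 0 (L \<theta>) - 1 / 3 * max 0 (- L \<theta>)"
    proof (cases "L \<theta> \<ge> 0")
      case True
      then show ?thesis using mult_right_mono[OF Kb(2)[of \<theta>] True] by (simp add: max_def)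
    next
      case False
      then have "K \<theta> * L \<theta> \<le> 1/3 * L \<theta>" using Kb(1)[of \<theta>] by (intro mult_right_mono_neg) auto
      then show ?thesis using False by (simp add: max_def)
    qed
  qed
  have dR: "ln (2 * R / d) \<ge> 0" using d R by (simp add: field_simps)
  \<comment> \<open>A zero in the half disc contributes at most -1/3 per multiplicity, any other
    zero at most 0, and a pole at most ln (2 * R / d).\<close>
  have "(\<Sum>a\<in>S. of_int (zorder f a) * ln (norm (blaschke R a z0)))
      \<le> (\<Sum>a\<in>S. - (1/3) * (if norm a \<le> R/2 then max 0 (real_of_int (zorder f a)) else 0)
          + max 0 (- real_of_int (zorder f a)) * ln (2 * R / d))"
  proof (intro sum_mono)
    fix a assume a: "a \<in> S"
    define b where "b = norm (blaschke R a z0)"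
    have aR: "norm a < R" using a by (simp add: S_def)
    have "d \<le> norm (z0 - a)" using a d by (force simp: S_def dist_norm)
    then have bl: "d / (2 * R) \<le> b" unfolding b_def using aR z0R d by (intro blaschke_norm_lower)
    then have b0: "b > 0" using d R by (smt (verit) divide_pos_pos)
    have "ln (d / (2 * R)) \<le> ln b" using bl d R b0 by (subst ln_le_cancel_iff) auto
    then have b1: "- ln b \<le> ln (2 * R / d)" using d R by (simp add: ln_div ln_mult)
    have b2: "ln b \<le> 0" using blaschke_norm[OF aR z0R] b0 by (simp add: b_def)
    have b3: "ln b \<le> - (1/3)" if "norm a \<le> R/2"
    proof -
      have "b \<le> 2/3" unfolding b_def using that z0 R by (intro blaschke_norm_two_thirds)
      then have "ln b \<le> ln (2/3)" using b0 by simp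
      then show ?thesis using ln_three_halves by (simp add: ln_div)
    qed
    show "of_int (zorder f a) * ln b \<le> - (1/3) * (if norm a \<le> R/2 then max 0 (real_of_int (zorder f a)) else 0)
          + max 0 (- real_of_int (zorder f a)) * ln (2 * R / d)"
    proof (cases "zorder f a \<ge> 0")
      case True
      then have "norm a \<le> R/2 \<Longrightarrow> of_int (zorder f a) * ln b \<le> of_int (zorder f a) * - (1/3)"
        using b3 by (intro mult_left_mono) auto
      moreover have "of_int (zorder f a) * ln b \<le> 0" using True b2 by (intro mult_nonneg_nonpos) auto
      ultimately show ?thesis using True by (auto simp: max_def)
    next
      case False
      then have "- real_of_int (zorder f a) * - ln b \<le> - real_of_int (zorder f a) * ln (2 * R / d)"
        using b1 by (intro mult_left_mono) auto
      then show ?thesis using False by (auto simp: max_def)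
    qed
  qed
  also have "\<dots> = - (1/3) * (\<Sum>a\<in>S. if norm a \<le> R/2 then max 0 (real_of_int (zorder f a)) else 0)
      + (\<Sum>a\<in>S. max 0 (- real_of_int (zorder f a))) * ln (2 * R / d)"
    unfolding sum.distrib by (simp only: sum_distrib_left sum_distrib_right)
  also have "(\<Sum>a\<in>S. if norm a \<le> R/2 then max 0 (real_of_int (zorder f a)) else 0) = Z"
    unfolding Z_def using fS R by (intro sum.mono_neutral_cong_right) (auto simp: S_def)
  also have "(\<Sum>a\<in>S. max 0 (- real_of_int (zorder f a))) * ln (2 * R / d) \<le> nev_n R f * ln (2 * R / d)"
    using dR by (intro mult_right_mono sum_neg_zorder_le) (auto simp: S_def)
  finally have 2: "(\<Sum>a\<in>S. of_int (zorder f a) * ln (norm (blaschke R a z0)))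
      \<le> - (1/3) * Z + nev_n R f * ln (2 * R / d)" by simp
  have "2 * pi * (ln (norm (f z0)) - (- (1/3) * Z + nev_n R f * ln (2 * R / d)))
     \<le> 2 * pi * (ln (norm (f z0)) - (\<Sum>a\<in>S. of_int (zorder f a) * ln (norm (blaschke R a z0))))"
    using 2 by (intro mult_left_mono) auto
  also note 1
  \<comment> \<open>Multiplication by 3 and moving the two negative terms to the left bounds the
    zero count and the negative part of the logarithm at once.\<close>
  finally have 3: "2 * pi * Z + I \<le> 2 * pi * (3 * Q)"
    unfolding Q_def by (simp add: algebra_simps)
  then have "2 * pi * Z \<le> 2 * pi * (3 * Q)" using I0 by linarith
  then show ?A unfolding Z_def[symmetric] by simp
  have "Z \<ge> 0" unfolding Z_def by (intro sum_nonneg) auto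
  then have "2 * pi * Z \<ge> 0" by simp
  then have "I \<le> 2 * pi * (3 * Q)" using 3 by linarith
  moreover have "((\<lambda>\<theta>. max 0 (L \<theta>) + max 0 (- L \<theta>)) has_integral 2 * pi * nev_m R f + I) {0..2*pi}"
    by (intro has_integral_add M I)
  then have "((\<lambda>\<theta>. \<bar>L \<theta>\<bar>) has_integral 2 * pi * nev_m R f + I) {0..2*pi}"
    by (rule has_integral_eq[rotated]) auto
  then have "integral {0..2*pi} (\<lambda>\<theta>. \<bar>L \<theta>\<bar>) = 2 * pi * nev_m R f + I" by (rule integral_unique)
  ultimately show ?B unfolding L_def by (simp add: algebra_simps)
qed

text \<open>Poles are controlled by \<open>nev_N_ge\<close>, zeros and the boundary logarithm by
  \<open>first_main_bound\<close>. The regular point \<open>z0\<close> and its distance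
  \<open>d\<close> from \<open>bad\<close> are fixed independently of \<open>R\<close>, so ln (2 * R
  / d) costs only one factor ln R.\<close>

lemma growth:
  assumes T: "\<forall>\<^sub>F r in at_top. nev_T r f \<le> r powr s" and s: "s \<ge> 0"
  obtains C R0 where "C \<ge> 0" "R0 \<ge> 3"
    "\<And>R. R \<ge> R0 \<Longrightarrow> (\<Sum>a\<in>bad \<inter> cball 0 R. \<bar>real_of_int (zorder f a)\<bar>) \<le> C * (R powr s * ln R)"
    "\<And>R. R \<ge> R0 \<Longrightarrow> sphere 0 R \<inter> bad = {} \<Longrightarrow>
      integral {0..2*pi} (\<lambda>\<theta>. \<bar>ln (norm (f (of_real R * cis \<theta>)))\<bar>) \<le> C * (R powr s * ln R)"
proof -
  obtain r0 where r0: "\<And>r. r \<ge> r0 \<Longrightarrow> nev_T r f \<le> r powr s"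
    using T by (auto simp: eventually_at_top_linorder)
  have "open (- bad)" using sparse_in_UNIV_imp_closed[OF sparse_bad] by auto
  moreover have "bad \<noteq> UNIV" using countable_bad uncountable_UNIV_complex by metis
  ultimately obtain z0 d0 where z0: "z0 \<notin> bad" "d0 > 0" "ball z0 d0 \<subseteq> - bad"
    by (metis ComplD ComplI UNIV_eq_I openE)
  define d where "d = min d0 1"
  have d: "0 < d" "d \<le> 1" "bad \<inter> ball z0 d = {}" using z0 by (auto simp: d_def)
  define R1 where "R1 = max (max 3 r0) (8 * norm z0)"
  have n: "nev_n R f \<le> 2 * 2 powr s * R powr s" and m: "nev_m R f \<le> R powr s" if R: "R \<ge> R1" for R
  proof -
    have R': "R \<ge> 3" "R \<ge> r0" using R by (auto simp: R1_def)
    have "nev_n R f * (1/2) \<le> nev_n R f * ln 2"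
      using nev_n_nonneg ln_2_less_1 ln2_ge_two_thirds by (intro mult_left_mono) auto
    also have "\<dots> \<le> nev_N (2 * R) f" using R' by (intro nev_N_ge) auto
    also have "\<dots> \<le> nev_T (2 * R) f" using nev_m_nonneg by (simp add: nev_T_def)
    also have "\<dots> \<le> (2 * R) powr s" using R' by (intro r0) auto
    also have "\<dots> = 2 powr s * R powr s" using R' by (simp add: powr_mult)
    finally show "nev_n R f \<le> 2 * 2 powr s * R powr s" by simp
    \<comment> \<open>A pole at the origin makes \<open>nev_N\<close> negative at small radii. Since
      \<open>R / 2 \<ge> 1\<close>, this does not happen here, and \<open>nev_m\<close> is bounded
      by \<open>nev_T\<close>.\<close>
    have "0 \<le> nev_n (R/2) f * ln 2" using nev_n_nonneg by simp
    also have "\<dots> \<le> nev_N (2 * (R/2)) f" using R' by (intro nev_N_ge) auto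
    finally have "nev_N R f \<ge> 0" by simp
    then show "nev_m R f \<le> R powr s" using r0[OF R'(2)] by (simp add: nev_T_def)
  qed
  define k where "k = 1 + ln (2 / d)"
  have k: "k \<ge> 0" using d by (auto simp: k_def intro!: add_nonneg_nonneg)
  define c where "c = 3 + 2 * 2 powr s * k + \<bar>ln (norm (f z0))\<bar>"
  have c: "c \<ge> 0" using k by (simp add: c_def)
  have Q: "3 * nev_m R f + nev_n R f * ln (2 * R / d) - ln (norm (f z0)) \<le> c * (R powr s * ln R)"
    if R: "R \<ge> R1" for R
  proof -
    have R': "R \<ge> 3" using R by (auto simp: R1_def)
    have l: "ln R \<ge> 1" using ln_ge_1[OF R'] .
    have p: "R powr s \<ge> 1" using R' s by (simp add: ge_one_powr_ge_zero)
    have pl: "R powr s * 1 \<le> R powr s * ln R" using l by (intro mult_left_mono) auto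
    have 1: "3 * nev_m R f \<le> 3 * (R powr s * ln R)" using m[OF R] pl by simp
    have "ln (2 * R / d) = ln R + ln (2 / d) * 1" using d R' by (simp add: ln_div ln_mult)
    also have "\<dots> \<le> ln R + ln (2/d) * ln R" using l d by (intro add_left_mono mult_left_mono) auto
    finally have "ln (2 * R / d) \<le> k * ln R" by (simp add: k_def algebra_simps)
    moreover have "ln (2 * R / d) \<ge> 0" using d R' by (simp add: field_simps)
    ultimately have "nev_n R f * ln (2 * R / d) \<le> (2 * 2 powr s * R powr s) * (k * ln R)"
      using n[OF R] nev_n_nonneg by (intro mult_mono) auto
    moreover have "\<bar>ln (norm (f z0))\<bar> * 1 \<le> \<bar>ln (norm (f z0))\<bar> * (R powr s * ln R)"
      using pl p by (intro mult_left_mono) auto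
    ultimately show ?thesis using 1 unfolding c_def by (simp add: algebra_simps)
  qed
  \<comment> \<open>The three summands serve the boundary integral, the poles and the zeros. The
    factor 3 powr s * 3 pays for the passage from \<open>R\<close> to a radius below 3 * R.\<close>
  define C where "C = 2 * pi * (1 + 3 * c) + 2 * 2 powr s + 3 * (c * (3 powr s * 3))"
  have C: "C \<ge> 2 * pi * (1 + 3 * c)" "C \<ge> 2 * 2 powr s + 3 * (c * (3 powr s * 3))"
    using c by (auto simp: C_def)
  have C0: "C \<ge> 0" using C(1) c by (intro order.trans[OF _ C(1)]) auto
  show ?thesis
  proof (rule that[OF C0])
    show "R1 \<ge> 3" by (simp add: R1_def)
  next
    fix R assume R: "R \<ge> R1"
    have R': "R \<ge> 3" "R \<ge> 8 * norm z0" using R by (auto simp: R1_def)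
    have l: "ln R \<ge> 1" using ln_ge_1 R' by simp
    have p: "R powr s \<ge> 1" using R' s by (simp add: ge_one_powr_ge_zero)
    have pl: "R powr s * 1 \<le> R powr s * ln R" using l by (intro mult_left_mono) auto
    \<comment> \<open>\<open>first_main_bound\<close> counts zeros in the half disc only and needs a
      circle free of bad points, hence a radius beyond 2 * R.\<close>
    obtain R2 where R2: "2 * R < R2" "R2 < 3 * R" "sphere 0 R2 \<inter> bad = {}"
      using generic_radius[of "2 * R" "3 * R"] R' by auto
    have "(\<Sum>a\<in>bad \<inter> cball 0 R. max 0 (real_of_int (zorder f a)))
        \<le> (\<Sum>a\<in>bad \<inter> cball 0 (R2/2). max 0 (real_of_int (zorder f a)))"
      using R2 finite_bad[of "cball 0 (R2/2)"] by (intro sum_mono2) auto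
    also have "\<dots> \<le> 3 * (3 * nev_m R2 f + nev_n R2 f * ln (2 * R2 / d) - ln (norm (f z0)))"
      using R' R2 d z0 by (intro first_main_bound) auto
    also have "\<dots> \<le> 3 * (c * (R2 powr s * ln R2))"
      using Q[of R2] R2 R R' by simp
    also have "R2 powr s * ln R2 \<le> (3 powr s * 3) * (R powr s * ln R)"
    proof -
      have "ln R2 \<le> ln (3 * R)" using R2 R' by simp
      also have "ln (3 * R) = ln 3 + ln R" using R' by (simp add: ln_mult)
      also have "\<dots> \<le> 3 * ln R"
      proof -
        have "ln (3::real) \<le> ln R" using R' by simp
        then show ?thesis using l by simp
      qed
      finally have "ln R2 \<le> 3 * ln R" .
      moreover have "R2 powr s \<le> (3 * R) powr s" using R2 R' s by (intro powr_mono2) auto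
      moreover have "(3 * R) powr s = 3 powr s * R powr s" using R' by (simp add: powr_mult)
      moreover have "ln R2 \<ge> 0" using R2 R' by simp
      ultimately have "R2 powr s * ln R2 \<le> (3 powr s * R powr s) * (3 * ln R)"
        by (intro mult_mono) auto
      then show ?thesis by (simp add: mult_ac)
    qed
    finally have 1: "(\<Sum>a\<in>bad \<inter> cball 0 R. max 0 (real_of_int (zorder f a)))
        \<le> 3 * (c * ((3 powr s * 3) * (R powr s * ln R)))" using c by (simp add: mult_left_mono)
    have "(\<Sum>a\<in>bad \<inter> cball 0 R. max 0 (- real_of_int (zorder f a))) \<le> nev_n R f"
      by (rule sum_neg_zorder_le) auto
    also have "\<dots> \<le> 2 * 2 powr s * (R powr s * 1)" using n[OF R] by simp
    also have "\<dots> \<le> 2 * 2 powr s * (R powr s * ln R)" by (rule mult_left_mono[OF pl]) simp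
    finally have 2: "(\<Sum>a\<in>bad \<inter> cball 0 R. max 0 (- real_of_int (zorder f a))) \<le> 2 * 2 powr s * (R powr s * ln R)" .
    have "(\<Sum>a\<in>bad \<inter> cball 0 R. \<bar>real_of_int (zorder f a)\<bar>)
        = (\<Sum>a\<in>bad \<inter> cball 0 R. max 0 (real_of_int (zorder f a)) + max 0 (- real_of_int (zorder f a)))"
      by (intro sum.cong) auto
    also have "\<dots> \<le> (2 * 2 powr s + 3 * (c * (3 powr s * 3))) * (R powr s * ln R)"
      using 1 2 by (simp add: sum.distrib algebra_simps)
    also have "\<dots> \<le> C * (R powr s * ln R)" using C l by (intro mult_right_mono) auto
    finally show "(\<Sum>a\<in>bad \<inter> cball 0 R. \<bar>real_of_int (zorder f a)\<bar>) \<le> C * (R powr s * ln R)" .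
    assume sph: "sphere 0 R \<inter> bad = {}"
    have "integral {0..2*pi} (\<lambda>\<theta>. \<bar>ln (norm (f (of_real R * cis \<theta>)))\<bar>)
        \<le> 2 * pi * (nev_m R f + 3 * (3 * nev_m R f + nev_n R f * ln (2 * R / d) - ln (norm (f z0))))"
      using R' d z0 by (intro first_main_bound sph) auto
    also have "\<dots> \<le> 2 * pi * (R powr s * ln R + 3 * (c * (R powr s * ln R)))"
      using Q[OF R] m[OF R] pl by (intro mult_left_mono add_mono) auto
    also have "\<dots> = (2 * pi * (1 + 3 * c)) * (R powr s * ln R)" by (simp add: algebra_simps)
    also have "\<dots> \<le> C * (R powr s * ln R)" using C l by (intro mult_right_mono) auto
    finally show "integral {0..2*pi} (\<lambda>\<theta>. \<bar>ln (norm (f (of_real R * cis \<theta>)))\<bar>) \<le> C * (R powr s * ln R)" .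
  qed
qed

end

subsection \<open>Avoiding zeros and poles on a square\<close>

text \<open>Bounds the increase of the logarithm of the modulus under a step of length 1. It
  decreases in \<open>\<bar>u\<bar>\<close> and its singularity is integrable, so it can be
  averaged.\<close>

definition ln_sing :: "real \<Rightarrow> real" where
  "ln_sing u = ln (1 + 1 / \<bar>u\<bar>)"

lemma ln_sing_nonneg: "ln_sing u \<ge> 0"
  by (simp add: ln_sing_def)

lemma ln_sing_mono: "v \<noteq> 0 \<Longrightarrow> \<bar>v\<bar> \<le> \<bar>u\<bar> \<Longrightarrow> ln_sing u \<le> ln_sing v"
  unfolding ln_sing_def by (subst ln_le_cancel_iff) (auto simp: field_simps add_pos_nonneg)

text \<open>The odd extension of (1 + u) * ln (1 + u) - u * ln u from positive \<open>u\<close>. It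
  vanishes at 0 and is continuous there, so it serves as a primitive across the singularity.\<close>

definition ln_sing_prim :: "real \<Rightarrow> real" where
  "ln_sing_prim u = sgn u * ln (1 + \<bar>u\<bar>) + u * ln (1 + \<bar>u\<bar>) - u * ln \<bar>u\<bar>"

lemma ln_sing_prim_deriv:
  assumes "u \<noteq> 0" shows "(ln_sing_prim has_real_derivative ln_sing u) (at u)"
proof -
  have pos: "(ln_sing_prim has_real_derivative ln_sing u) (at u)" if "u > 0" for u
  proof -
    have "((\<lambda>u. (1 + u) * ln (1 + u) - u * ln u) has_real_derivative ln_sing u) (at u)"
      using that by (auto intro!: derivative_eq_intros simp: ln_sing_def field_simps ln_div)
    then show ?thesis
      by (rule has_field_derivative_transform_within_open[of _ _ _ "{0<..}"])
         (use that in \<open>auto simp: ln_sing_prim_def algebra_simps\<close>)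
  qed
  show ?thesis
  proof (cases "u > 0")
    case False
    have "((\<lambda>u. - ln_sing_prim (- u)) has_real_derivative - (ln_sing (- u) * - 1)) (at u)"
      using False assms by (intro DERIV_minus DERIV_chain2[OF pos]) (auto intro!: derivative_eq_intros)
    moreover have "(\<lambda>u. - ln_sing_prim (- u)) = ln_sing_prim"
      by (auto simp: ln_sing_prim_def)
    ultimately show ?thesis by (simp add: ln_sing_def)
  qed (use pos in auto)
qed

lemma isCont_ln_sing_prim: "isCont ln_sing_prim u"
proof (cases "u = 0")
  case True
  have "(ln_sing_prim \<longlongrightarrow> 0) (at 0)"
    unfolding ln_sing_prim_def[abs_def] by (rule filterlim_split_at; real_asymp)
  then show ?thesis using True by (simp add: isCont_def ln_sing_prim_def)
qed (use ln_sing_prim_deriv DERIV_isCont in blast)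

text \<open>The modulus equals ln (1 + \<bar>u\<bar>) + \<bar>u\<bar> * ln (1 + 1 / \<bar>u\<bar>)
  for nonzero \<open>u\<close>, and the second summand is at most 1.\<close>

lemma ln_sing_prim_bound: "\<bar>ln_sing_prim u\<bar> \<le> ln (1 + \<bar>u\<bar>) + 1"
proof (cases "u = 0")
  case False
  have "ln_sing_prim u = sgn u * (ln (1 + \<bar>u\<bar>) + \<bar>u\<bar> * (ln (1 + \<bar>u\<bar>) - ln \<bar>u\<bar>))"
    using False by (cases "u > 0") (simp_all add: ln_sing_prim_def right_diff_distrib)
  then have "\<bar>ln_sing_prim u\<bar> = \<bar>ln (1 + \<bar>u\<bar>) + \<bar>u\<bar> * (ln (1 + \<bar>u\<bar>) - ln \<bar>u\<bar>)\<bar>"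
    using False by (simp add: abs_mult)
  moreover have "ln (1 + \<bar>u\<bar>) - ln \<bar>u\<bar> = ln (1 + 1 / \<bar>u\<bar>)"
  proof -
    have "1 + 1 / \<bar>u\<bar> = (1 + \<bar>u\<bar>) / \<bar>u\<bar>" using False by (simp add: field_simps)
    then show ?thesis using False by (simp add: ln_div)
  qed
  moreover have "ln (1 + 1 / \<bar>u\<bar>) \<le> 1 / \<bar>u\<bar>" by (intro ln_add_one_self_le_self) simp
  then have "\<bar>u\<bar> * ln (1 + 1 / \<bar>u\<bar>) \<le> \<bar>u\<bar> * (1 / \<bar>u\<bar>)" by (intro mult_left_mono) auto
  then have "\<bar>u\<bar> * ln (1 + 1 / \<bar>u\<bar>) \<le> 1" using False by simp
  moreover have "\<bar>u\<bar> * ln (1 + 1 / \<bar>u\<bar>) \<ge> 0" "ln (1 + \<bar>u\<bar>) \<ge> 0" by simp_all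
  ultimately show ?thesis by simp
qed (simp add: ln_sing_prim_def)

text \<open>The bound is only logarithmic in \<open>U\<close>, so the mean over an interval of
  length comparable to \<open>U\<close> is of size ln U / U.\<close>

lemma ln_sing_integral:
  assumes "a \<le> b" "\<bar>a - c\<bar> \<le> U" "\<bar>b - c\<bar> \<le> U"
  obtains I where "((\<lambda>t. ln_sing (t - c)) has_integral I) {a..b}" "I \<le> 2 * (ln (1 + U) + 1)"
proof
  show "((\<lambda>t. ln_sing (t - c)) has_integral (ln_sing_prim (b - c) - ln_sing_prim (a - c))) {a..b}"
  proof (rule fundamental_theorem_of_calculus_interior_strong[of "{c}"])
    show "continuous_on {a..b} (\<lambda>t. ln_sing_prim (t - c))"
      by (intro continuous_at_imp_continuous_on ballI isCont_o2[OF _ isCont_ln_sing_prim] continuous_intros)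
    fix x assume "x \<in> {a<..<b} - {c}"
    then have "((\<lambda>t. ln_sing_prim (t - c)) has_real_derivative ln_sing (x - c) * 1) (at x)"
      by (intro DERIV_chain2[OF ln_sing_prim_deriv]) (auto intro!: derivative_eq_intros)
    then show "((\<lambda>t. ln_sing_prim (t - c)) has_vector_derivative ln_sing (x - c)) (at x)"
      by (simp add: has_real_derivative_iff_has_vector_derivative)
  qed (use assms in auto)
  have "ln (1 + \<bar>b - c\<bar>) \<le> ln (1 + U)" "ln (1 + \<bar>a - c\<bar>) \<le> ln (1 + U)"
    using assms by auto
  then show "ln_sing_prim (b - c) - ln_sing_prim (a - c) \<le> 2 * (ln (1 + U) + 1)"
    using abs_le_D1[OF order.trans[OF ln_sing_prim_bound[of "b - c"]], of "ln (1 + U) + 1"]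
      abs_le_D2[OF order.trans[OF ln_sing_prim_bound[of "a - c"]], of "ln (1 + U) + 1"]
    by auto
qed

text \<open>Somewhere off a null set a function does not exceed its mean. The summand 1 puts the
  bound strictly above the mean, so weak inequalities suffice for the contradiction.\<close>

lemma exists_small_weighted_sum:
  fixes \<sigma> :: "'a \<Rightarrow> real \<Rightarrow> real"
  assumes fin: "finite S" and w: "\<And>a. a \<in> S \<Longrightarrow> w a \<ge> 0" and ab: "a < b" and E: "countable E"
    and int: "\<And>a'. a' \<in> S \<Longrightarrow> \<exists>I\<le>J. (\<sigma> a' has_integral I) {a..b}"
  shows "\<exists>t\<in>{a..b} - E. (\<Sum>a'\<in>S. w a' * \<sigma> a' t) \<le> ((\<Sum>a'\<in>S. w a') * J + 1) / (b - a)"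
proof (rule ccontr)
  define B where "B = ((\<Sum>a'\<in>S. w a') * J + 1) / (b - a)"
  assume "\<not> ?thesis"
  then have neg: "B \<le> (\<Sum>a'\<in>S. w a' * \<sigma> a' t)" if "t \<in> {a..b} - E" for t
    using that by (force simp: B_def)
  obtain I where I: "\<And>a'. a' \<in> S \<Longrightarrow> I a' \<le> J" "\<And>a'. a' \<in> S \<Longrightarrow> (\<sigma> a' has_integral I a') {a..b}"
    using int by metis
  have neglE: "negligible E"
    using null_sets_completionI[OF countable_imp_null_set_lborel[OF E]] by (simp add: negligible_iff_null_sets)
  have "((\<lambda>t. \<Sum>a'\<in>S. w a' * \<sigma> a' t) has_integral (\<Sum>a'\<in>S. w a' * I a')) {a..b}"
    using I(2) fin by (intro has_integral_sum has_integral_mult_right)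
  \<comment> \<open>The lower bound \<open>B\<close> is known only off \<open>E\<close>, so the
    integrand is set to \<open>B\<close> on this null set.\<close>
  then have int': "((\<lambda>t. if t \<in> E then B else \<Sum>a'\<in>S. w a' * \<sigma> a' t) has_integral (\<Sum>a'\<in>S. w a' * I a')) {a..b}"
    by (rule has_integral_spike[rotated 2, OF _ neglE]) auto
  have "((\<lambda>t. B) has_integral (b - a) * B) {a..b}"
    using has_integral_const_real[of B a b] ab by simp
  then have "(b - a) * B \<le> (\<Sum>a'\<in>S. w a' * I a')"
    using int' by (rule has_integral_le) (use neg in auto)
  also have "\<dots> \<le> (\<Sum>a'\<in>S. w a' * J)" using I w by (intro sum_mono mult_left_mono) auto
  also have "\<dots> = (\<Sum>a'\<in>S. w a') * J" by (simp add: sum_distrib_right)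
  finally show False using ab by (simp add: B_def)
qed

lemma ln_norm_add_i_diff:
  assumes "u \<noteq> 0" "u + \<i> \<noteq> 0"
  shows "\<bar>ln (norm (u + \<i>)) - ln (norm u)\<bar> \<le> ln_sing (norm u) + ln_sing (norm (u + \<i>))"
proof -
  have *: "ln (norm v) - ln (norm u) \<le> ln_sing (norm u)" if "u \<noteq> 0" "v \<noteq> 0" "norm (v - u) = 1" for u v :: complex
  proof -
    have "norm v \<le> norm u + 1" using norm_triangle_ineq[of u "v - u"] that by simp
    then have "norm v / norm u \<le> 1 + 1 / norm u" using that by (simp add: field_simps)
    then have "ln (norm v / norm u) \<le> ln_sing (norm u)"
      unfolding ln_sing_def using that by (subst ln_le_cancel_iff) (auto simp: add_pos_nonneg)
    then show ?thesis using that by (simp add: ln_div)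
  qed
  show ?thesis
    using *[of u "u + \<i>"] *[of "u + \<i>" u] assms ln_sing_nonneg[of "norm u"] ln_sing_nonneg[of "norm (u + \<i>)"]
    by (simp add: abs_le_iff)
qed

lemma abs_ln_diff_le:
  assumes "A \<ge> m" "B \<ge> m" "m > (0::real)"
  shows "\<bar>ln A - ln B\<bar> \<le> \<bar>A - B\<bar> / m"
proof -
  have *: "ln A - ln B \<le> \<bar>A - B\<bar> / m" if "A \<ge> m" "B \<ge> m" for A B
  proof -
    have "ln A - ln B \<le> (A - B) / B" using that assms by (intro ln_diff_le) auto
    also have "\<dots> \<le> \<bar>A - B\<bar> / m" using that assms by (intro frac_le) auto
    finally show ?thesis .
  qed
  show ?thesis using *[of A B] *[of B A] assms by (simp add: abs_le_iff abs_minus_commute)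
qed

text \<open>
  On the boundary of the square of half-side \<open>t\<close>, both \<open>z\<close> and \<open>z + \<i>\<close> have real part \<open>\<plusminus>t\<close> or
  imaginary part in \<open>{\<plusminus>t, \<plusminus>t \<plusminus> 1}\<close>, so their distance to a point is bounded below in
  terms of \<open>t\<close> alone.
\<close>

definition square_weight :: "complex \<Rightarrow> real \<Rightarrow> real" where
  "square_weight \<alpha> t = ln_sing (t - \<bar>Re \<alpha>\<bar>) + ln_sing (t - \<bar>Im \<alpha>\<bar>)
     + ln_sing (t - (\<bar>Im \<alpha>\<bar> - 1)) + ln_sing (t - (\<bar>Im \<alpha>\<bar> + 1))"

lemma square_weight_minus: "square_weight (- \<alpha>) t = square_weight \<alpha> t"
  by (simp add: square_weight_def)

text \<open>At these half-sides a term of \<open>square_weight\<close> has the junk value \<open>ln_sing 0 = 0\<close>.\<close>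

definition square_exceptions :: "complex \<Rightarrow> real set" where
  "square_exceptions \<alpha> = {\<bar>Re \<alpha>\<bar>, \<bar>Im \<alpha>\<bar>, \<bar>Im \<alpha>\<bar> - 1, \<bar>Im \<alpha>\<bar> + 1}"

text \<open>Each of the two terms from \<open>ln_norm_add_i_diff\<close> is dominated by one of the
  four nonnegative summands of the weight, hence the factor 2.\<close>

lemma square_weight_bound:
  assumes t: "t \<notin> square_exceptions \<alpha>" "t \<ge> 1" and z: "\<bar>Re z\<bar> = t \<or> \<bar>Im z\<bar> = t"
  shows "z - \<alpha> \<noteq> 0" "z - \<alpha> + \<i> \<noteq> 0"
    "\<bar>ln (norm (z - \<alpha> + \<i>)) - ln (norm (z - \<alpha>))\<bar> \<le> 2 * square_weight \<alpha> t"
proof -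
  have key: "u \<noteq> 0 \<and> ln_sing (norm u) \<le> square_weight \<alpha> t"
    if u: "(v \<in> {t - \<bar>Re \<alpha>\<bar>, t - \<bar>Im \<alpha>\<bar>, t - (\<bar>Im \<alpha>\<bar> - 1), t - (\<bar>Im \<alpha>\<bar> + 1)} \<and> \<bar>v\<bar> \<le> norm u)" for u v
  proof -
    have v: "v \<noteq> 0" using u t by (auto simp: square_exceptions_def)
    then have "ln_sing (norm u) \<le> ln_sing v" using u by (intro ln_sing_mono) auto
    also have "\<dots> \<le> square_weight \<alpha> t"
    proof -
      have "ln_sing v \<in> {ln_sing (t - \<bar>Re \<alpha>\<bar>), ln_sing (t - \<bar>Im \<alpha>\<bar>),
          ln_sing (t - (\<bar>Im \<alpha>\<bar> - 1)), ln_sing (t - (\<bar>Im \<alpha>\<bar> + 1))}"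
        using u by blast
      moreover have "e \<le> A + B + C + D"
        if "e \<in> {A, B, C, D}" "A \<ge> 0" "B \<ge> 0" "C \<ge> 0" "D \<ge> 0" for e A B C D :: real
        using that by auto
      ultimately show ?thesis unfolding square_weight_def using ln_sing_nonneg by blast
    qed
    finally show ?thesis using u v by auto
  qed
  have 1: "\<exists>v. v \<in> {t - \<bar>Re \<alpha>\<bar>, t - \<bar>Im \<alpha>\<bar>, t - (\<bar>Im \<alpha>\<bar> - 1), t - (\<bar>Im \<alpha>\<bar> + 1)} \<and> \<bar>v\<bar> \<le> norm (z - \<alpha>)"
    using z
  proof
    assume "\<bar>Re z\<bar> = t"
    then have "\<bar>t - \<bar>Re \<alpha>\<bar>\<bar> \<le> \<bar>Re (z - \<alpha>)\<bar>"
      using abs_triangle_ineq3[of "Re z" "Re \<alpha>"] by simp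
    then show ?thesis using abs_Re_le_cmod[of "z - \<alpha>"] by (meson insertCI order_trans)
  next
    assume "\<bar>Im z\<bar> = t"
    then have "\<bar>t - \<bar>Im \<alpha>\<bar>\<bar> \<le> \<bar>Im (z - \<alpha>)\<bar>"
      using abs_triangle_ineq3[of "Im z" "Im \<alpha>"] by simp
    then show ?thesis using abs_Im_le_cmod[of "z - \<alpha>"] by (meson insertCI order_trans)
  qed
  have 2: "\<exists>v. v \<in> {t - \<bar>Re \<alpha>\<bar>, t - \<bar>Im \<alpha>\<bar>, t - (\<bar>Im \<alpha>\<bar> - 1), t - (\<bar>Im \<alpha>\<bar> + 1)} \<and> \<bar>v\<bar> \<le> norm (z - \<alpha> + \<i>)"
    using z
  proof
    assume "\<bar>Re z\<bar> = t"
    then have "\<bar>t - \<bar>Re \<alpha>\<bar>\<bar> \<le> \<bar>Re (z - \<alpha> + \<i>)\<bar>"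
      using abs_triangle_ineq3[of "Re z" "Re \<alpha>"] by simp
    then show ?thesis using abs_Re_le_cmod[of "z - \<alpha> + \<i>"] by (meson insertCI order_trans)
  next
    assume a: "\<bar>Im z\<bar> = t"
    \<comment> \<open>The translate of the upper side has height t + 1, that of the lower side 1 -
      t. As \<open>t \<ge> 1\<close>, their absolute values are t + 1 and t - 1, which accounts for
      the two shifted arguments.\<close>
    have "\<bar>t - (\<bar>Im \<alpha>\<bar> - 1)\<bar> \<le> \<bar>Im (z - \<alpha> + \<i>)\<bar> \<or> \<bar>t - (\<bar>Im \<alpha>\<bar> + 1)\<bar> \<le> \<bar>Im (z - \<alpha> + \<i>)\<bar>"
    proof (cases "Im z \<ge> 0")
      case True
      then have "\<bar>\<bar>t + 1\<bar> - \<bar>Im \<alpha>\<bar>\<bar> \<le> \<bar>Im (z - \<alpha> + \<i>)\<bar>"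
        using a abs_triangle_ineq3[of "t + 1" "Im \<alpha>"] by (simp add: algebra_simps)
      then show ?thesis using t(2) by (simp add: algebra_simps)
    next
      case False
      then have "Im (z - \<alpha> + \<i>) = - (t - 1 - - Im \<alpha>)" using a by simp
      then have "\<bar>\<bar>t - 1\<bar> - \<bar>- Im \<alpha>\<bar>\<bar> \<le> \<bar>Im (z - \<alpha> + \<i>)\<bar>"
        using abs_triangle_ineq3[of "t - 1" "- Im \<alpha>"] by (simp only: abs_minus_cancel)
      then show ?thesis using t(2) by (simp add: algebra_simps)
    qed
    then show ?thesis by (meson abs_Im_le_cmod insertCI order_trans)
  qed
  obtain v1 v2 where
    "v1 \<in> {t - \<bar>Re \<alpha>\<bar>, t - \<bar>Im \<alpha>\<bar>, t - (\<bar>Im \<alpha>\<bar> - 1), t - (\<bar>Im \<alpha>\<bar> + 1)} \<and> \<bar>v1\<bar> \<le> norm (z - \<alpha>)"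
    "v2 \<in> {t - \<bar>Re \<alpha>\<bar>, t - \<bar>Im \<alpha>\<bar>, t - (\<bar>Im \<alpha>\<bar> - 1), t - (\<bar>Im \<alpha>\<bar> + 1)} \<and> \<bar>v2\<bar> \<le> norm (z - \<alpha> + \<i>)"
    using 1 2 by blast
  note k = this[THEN key]
  then show "z - \<alpha> \<noteq> 0" "z - \<alpha> + \<i> \<noteq> 0" by blast+
  then show "\<bar>ln (norm (z - \<alpha> + \<i>)) - ln (norm (z - \<alpha>))\<bar> \<le> 2 * square_weight \<alpha> t"
    using ln_norm_add_i_diff[of "z - \<alpha>"] k by linarith
qed

text \<open>Each of the four summands contributes at most 2 * (ln (1 + 12 * \<rho>) + 1). The radius
  9 * \<rho> covers the square roots of all points of modulus below 65 * \<rho>^2.\<close>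

lemma square_weight_integral:
  assumes "\<rho> \<ge> 1" "norm \<alpha> \<le> 9 * \<rho>"
  shows "\<exists>I \<le> 8 * (ln (1 + 12 * \<rho>) + 1). (square_weight \<alpha> has_integral I) {\<rho>..2*\<rho>}"
proof -
  have "\<bar>Re \<alpha>\<bar> \<le> 9 * \<rho>" "\<bar>Im \<alpha>\<bar> \<le> 9 * \<rho>"
    using assms abs_Re_le_cmod[of \<alpha>] abs_Im_le_cmod[of \<alpha>] by linarith+
  then have *: "\<exists>I \<le> 2 * (ln (1 + 12 * \<rho>) + 1). ((\<lambda>t. ln_sing (t - c)) has_integral I) {\<rho>..2*\<rho>}"
    if "c \<in> {\<bar>Re \<alpha>\<bar>, \<bar>Im \<alpha>\<bar>, \<bar>Im \<alpha>\<bar> - 1, \<bar>Im \<alpha>\<bar> + 1}" for c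
  proof -
    have "- 1 \<le> c" "c \<le> 9 * \<rho> + 1" using that \<open>\<bar>Re \<alpha>\<bar> \<le> 9 * \<rho>\<close> \<open>\<bar>Im \<alpha>\<bar> \<le> 9 * \<rho>\<close> by auto
    then have "\<bar>\<rho> - c\<bar> \<le> 12 * \<rho>" "\<bar>2 * \<rho> - c\<bar> \<le> 12 * \<rho>" "\<rho> \<le> 2 * \<rho>"
      using assms(1) by linarith+
    then show ?thesis using ln_sing_integral[of \<rho> "2*\<rho>" c "12 * \<rho>"] by blast
  qed
  obtain I1 I2 I3 I4 where I:
    "I1 \<le> 2 * (ln (1 + 12 * \<rho>) + 1)" "((\<lambda>t. ln_sing (t - \<bar>Re \<alpha>\<bar>)) has_integral I1) {\<rho>..2*\<rho>}"
    "I2 \<le> 2 * (ln (1 + 12 * \<rho>) + 1)" "((\<lambda>t. ln_sing (t - \<bar>Im \<alpha>\<bar>)) has_integral I2) {\<rho>..2*\<rho>}"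
    "I3 \<le> 2 * (ln (1 + 12 * \<rho>) + 1)" "((\<lambda>t. ln_sing (t - (\<bar>Im \<alpha>\<bar> - 1))) has_integral I3) {\<rho>..2*\<rho>}"
    "I4 \<le> 2 * (ln (1 + 12 * \<rho>) + 1)" "((\<lambda>t. ln_sing (t - (\<bar>Im \<alpha>\<bar> + 1))) has_integral I4) {\<rho>..2*\<rho>}"
    using *[of "\<bar>Re \<alpha>\<bar>"] *[of "\<bar>Im \<alpha>\<bar>"] *[of "\<bar>Im \<alpha>\<bar> - 1"] *[of "\<bar>Im \<alpha>\<bar> + 1"]
    by (metis insertCI)
  have "(square_weight \<alpha> has_integral (I1 + I2 + I3 + I4)) {\<rho>..2*\<rho>}"
    unfolding square_weight_def[abs_def] by (intro has_integral_add I)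
  moreover have "I1 + I2 + I3 + I4 \<le> 8 * (ln (1 + 12 * \<rho>) + 1)" using I by linarith
  ultimately show ?thesis by blast
qed

section \<open>The quotient estimate on the boundary of a suitable square\<close>

context nontrivial_meromorphic
begin

text \<open>Poisson-Jensen at z^2 is subtracted from Poisson-Jensen at (z + \<i>)^2. The integrals
  differ by at most P / \<rho> through \<open>poisson_kernel_diff\<close>. The Blaschke sums are
  controlled by the choice of \<open>t\<close>, which makes the weighted sum of all singular terms
  at most (W * J + 1) / \<rho>.\<close>

lemma shift_bound_on_square:
  assumes R0: "R0 \<ge> 3" and C: "C \<ge> 0"
    and cnt: "\<And>R. R \<ge> R0 \<Longrightarrow> (\<Sum>a\<in>bad \<inter> cball 0 R. \<bar>real_of_int (zorder f a)\<bar>) \<le> C * (R powr s * ln R)"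
    and int: "\<And>R. R \<ge> R0 \<Longrightarrow> sphere 0 R \<inter> bad = {} \<Longrightarrow>
      integral {0..2*pi} (\<lambda>\<theta>. \<bar>ln (norm (f (of_real R * cis \<theta>)))\<bar>) \<le> C * (R powr s * ln R)"
    and \<rho>: "\<rho> \<ge> R0" and E: "countable E" and s: "s \<ge> 0"
  shows "\<exists>t\<in>{\<rho>..2*\<rho>} - E. \<forall>z. (\<bar>Re z\<bar> = t \<and> \<bar>Im z\<bar> \<le> t \<or> \<bar>Im z\<bar> = t \<and> \<bar>Re z\<bar> \<le> t) \<longrightarrow>
     z\<^sup>2 \<notin> bad \<longrightarrow> (z + \<i>)\<^sup>2 \<notin> bad \<longrightarrow>
     ln (norm (f ((z + \<i>)\<^sup>2))) - ln (norm (f (z\<^sup>2)))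
       \<le> (1200 * C * 65 powr s + 4) * (\<rho> powr (2 * s - 1) * (ln \<rho>)\<^sup>2)"
proof -
  have \<rho>3: "\<rho> \<ge> 3" using \<rho> R0 by linarith
  have l: "ln \<rho> \<ge> 1" using ln_ge_1[OF \<rho>3] .
  have add_diffs: "\<bar>(p + p') - (q + q')\<bar> \<le> u + v" if "\<bar>p - q\<bar> \<le> u" "\<bar>p' - q'\<bar> \<le> v" for p p' q q' u v :: real
    using that by linarith
  have sub_diffs: "\<bar>(k + p - q') - (k + q - p')\<bar> \<le> u + v" if "\<bar>p - q\<bar> \<le> u" "\<bar>p' - q'\<bar> \<le> v" for k p p' q q' u v :: real
    using that by linarith
  have \<rho>2: "\<rho> * \<rho> \<ge> 3 * \<rho>" using \<rho>3 by (intro mult_right_mono) auto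
  \<comment> \<open>Both points have modulus at most (4 * \<rho>)^2, and 64 * \<rho>^2 is four times
    this, as \<open>poisson_kernel_diff\<close> requires.\<close>
  obtain R where R: "64 * \<rho>\<^sup>2 < R" "R < 65 * \<rho>\<^sup>2" "sphere 0 R \<inter> bad = {}"
    using generic_radius[of "64 * \<rho>\<^sup>2" "65 * \<rho>\<^sup>2"] \<rho>3 by auto
  have RR0: "R \<ge> R0" using R(1) \<rho>2 \<rho> R0 unfolding power2_eq_square by linarith
  have Rpos: "R > 0" using RR0 R0 by simp
  define S where "S = bad \<inter> ball 0 R"
  have fS: "finite S" unfolding S_def
    by (rule finite_subset[OF _ finite_bad[of "cball 0 R"]]) auto
  define w where "w = (\<lambda>a. \<bar>real_of_int (zorder f a)\<bar>)"
  define W where "W = (\<Sum>a\<in>S. w a)"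
  define P where "P = C * (R powr s * ln R)"
  have "W \<le> (\<Sum>a\<in>bad \<inter> cball 0 R. w a)"
    unfolding W_def S_def w_def using finite_bad[of "cball 0 R"] by (intro sum_mono2) auto
  also have "\<dots> \<le> P" unfolding w_def P_def using cnt[OF RR0] .
  finally have WP: "W \<le> P" .
  have W0: "W \<ge> 0" unfolding W_def w_def by (intro sum_nonneg) auto
  define J where "J = 8 * (ln (1 + 12 * \<rho>) + 1)"
  have J0: "J \<ge> 0" unfolding J_def using \<rho>3 by simp
  define E' where "E' = E \<union> (\<Union>a\<in>S. square_exceptions (csqrt a))"
  have E': "countable E'"
    unfolding E'_def using E fS by (auto simp: square_exceptions_def intro!: countable_finite)
  have "\<exists>I\<le>J. (square_weight (csqrt a) has_integral I) {\<rho>..2*\<rho>}" if a: "a \<in> S" for a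
    unfolding J_def
  proof (rule square_weight_integral)
    have "norm a \<le> (9 * \<rho>)\<^sup>2" using a R \<rho>3 by (simp add: S_def power2_eq_square)
    then show "norm (csqrt a) \<le> 9 * \<rho>" using \<rho>3 by (simp add: norm_csqrt real_le_lsqrt)
  qed (use \<rho>3 in auto)
  then have "\<exists>t\<in>{\<rho>..2*\<rho>} - E'.
      (\<Sum>a\<in>S. w a * square_weight (csqrt a) t) \<le> (W * J + 1) / (2*\<rho> - \<rho>)"
    unfolding W_def using \<rho>3 by (intro exists_small_weighted_sum fS E') (auto simp: w_def)
  then obtain t where t: "t \<in> {\<rho>..2*\<rho>} - E'"
    "(\<Sum>a\<in>S. w a * square_weight (csqrt a) t) \<le> (W * J + 1) / (2*\<rho> - \<rho>)"
    by blast
  show ?thesis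
  proof (intro bexI[of _ t] allI impI)
    show "t \<in> {\<rho>..2*\<rho>} - E" using t by (auto simp: E'_def)
    fix z assume sq: "\<bar>Re z\<bar> = t \<and> \<bar>Im z\<bar> \<le> t \<or> \<bar>Im z\<bar> = t \<and> \<bar>Re z\<bar> \<le> t"
      and zb: "z\<^sup>2 \<notin> bad" "(z + \<i>)\<^sup>2 \<notin> bad"
    define x where "x = z\<^sup>2"
    define y where "y = (z + \<i>)\<^sup>2"
    have t1: "t \<ge> 1" "t \<le> 2 * \<rho>" using t \<rho>3 by auto
    have "\<bar>Re z\<bar> \<le> \<bar>t\<bar>" "\<bar>Im z\<bar> \<le> \<bar>t\<bar>" using sq t1(1) by auto
    then have "(norm z)\<^sup>2 \<le> t\<^sup>2 + t\<^sup>2"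
      unfolding cmod_power2 by (intro add_mono) (simp_all only: abs_le_square_iff)
    also have "\<dots> \<le> 2 * (2 * \<rho>)\<^sup>2" using t1 power_mono[of t "2 * \<rho>" 2] by simp
    also have "\<dots> \<le> (3 * \<rho>)\<^sup>2" by (simp add: power2_eq_square)
    finally have nz: "norm z \<le> 3 * \<rho>" using \<rho>3 by (intro power2_le_imp_le[of "norm z" "3 * \<rho>"]) auto
    have nzi: "norm (z + \<i>) \<le> 4 * \<rho>" using norm_triangle_ineq[of z \<i>] nz \<rho>3 by simp
    have "(norm z)\<^sup>2 \<le> 9 * \<rho>\<^sup>2" using power_mono[OF nz norm_ge_zero, of 2] by (simp add: power_mult_distrib)
    then have nx: "norm x \<le> R / 4"
      using R(1) zero_le_power2[of \<rho>] unfolding x_def norm_power by linarith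
    have ny: "norm y \<le> R / 4"
      unfolding y_def norm_power using power_mono[OF nzi, of 2] R(1) by (simp add: power2_eq_square)
    have "y - x = 2 * \<i> * z - 1" by (simp add: x_def y_def power2_eq_square algebra_simps)
    then have "norm (y - x) \<le> 2 * norm z + 1" using norm_triangle_ineq4[of "2 * \<i> * z" 1] by (simp add: norm_mult)
    then have nyx: "norm (y - x) \<le> 7 * \<rho>" using nz \<rho>3 by linarith
    have small: "4 * norm (y - x) / R \<le> 1 / \<rho>"
    proof -
      have "4 * norm (y - x) * \<rho> \<le> 28 * \<rho> * \<rho>" using nyx \<rho>3 by (intro mult_right_mono) auto
      also have "\<dots> \<le> R" using R by (simp add: power2_eq_square)
      finally show ?thesis using Rpos \<rho>3 by (simp add: field_simps)
    qed
    define L where "L = (\<lambda>\<theta>. ln (norm (f (of_real R * cis \<theta>))))"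
    have contL: "continuous_on {0..2*pi} L" unfolding L_def by (rule continuous_on_ln_circle[OF Rpos R(3)])
    have xR: "norm x < R" "norm y < R" using nx ny Rpos by linarith+
    define Bx where "Bx = (\<Sum>a\<in>S. of_int (zorder f a) * ln (norm (blaschke R a x)))"
    define By where "By = (\<Sum>a\<in>S. of_int (zorder f a) * ln (norm (blaschke R a y)))"
    have "((\<lambda>\<theta>. poisson_kernel R y \<theta> * L \<theta> - poisson_kernel R x \<theta> * L \<theta>) has_integral
        2 * pi * (ln (norm (f y)) - By) - 2 * pi * (ln (norm (f x)) - Bx)) {0..2*pi}"
      unfolding L_def Bx_def By_def S_def using zb xR
      by (intro has_integral_diff poisson_jensen[OF Rpos R(3)]) (auto simp: x_def y_def)
    moreover have "((\<lambda>\<theta>. 1 / \<rho> * \<bar>L \<theta>\<bar>) has_integral 1 / \<rho> * integral {0..2*pi} (\<lambda>\<theta>. \<bar>L \<theta>\<bar>)) {0..2*pi}"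
      using contL by (intro has_integral_mult_right integrable_integral integrable_continuous_real continuous_intros)
    ultimately have "2 * pi * (ln (norm (f y)) - By) - 2 * pi * (ln (norm (f x)) - Bx)
        \<le> 1 / \<rho> * integral {0..2*pi} (\<lambda>\<theta>. \<bar>L \<theta>\<bar>)"
    proof (rule has_integral_le)
      fix \<theta>
      have "poisson_kernel R y \<theta> * L \<theta> - poisson_kernel R x \<theta> * L \<theta>
          \<le> \<bar>poisson_kernel R y \<theta> - poisson_kernel R x \<theta>\<bar> * \<bar>L \<theta>\<bar>"
        unfolding left_diff_distrib[symmetric] abs_mult[symmetric] by (rule abs_ge_self)
      also have "\<dots> \<le> 1 / \<rho> * \<bar>L \<theta>\<bar>"
        using poisson_kernel_diff[OF ny nx Rpos, of \<theta>] small by (intro mult_right_mono) auto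
      finally show "poisson_kernel R y \<theta> * L \<theta> - poisson_kernel R x \<theta> * L \<theta> \<le> 1 / \<rho> * \<bar>L \<theta>\<bar>" .
    qed
    also have "\<dots> \<le> 1 / \<rho> * P"
      using int[OF RR0 R(3)] \<rho>3 unfolding L_def P_def by (intro mult_left_mono) auto
    finally have a: "2 * pi * (ln (norm (f y)) - By - (ln (norm (f x)) - Bx)) \<le> P / \<rho>"
      by (simp add: algebra_simps)
    have P0: "P / \<rho> \<ge> 0" using WP W0 \<rho>3 by simp
    have "ln (norm (f y)) - By - (ln (norm (f x)) - Bx) \<le> P / \<rho>"
    proof (cases "ln (norm (f y)) - By - (ln (norm (f x)) - Bx) \<ge> 0")
      case True
      then have "1 * (ln (norm (f y)) - By - (ln (norm (f x)) - Bx))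
          \<le> 2 * pi * (ln (norm (f y)) - By - (ln (norm (f x)) - Bx))"
        using pi_gt3 by (intro mult_right_mono) auto
      from order.trans[OF this a] show ?thesis by simp
    qed (use P0 in linarith)
    moreover have "By - Bx \<le> (4 * (P * J + 1) + P) / \<rho>"
    proof -
      have "By - Bx = (\<Sum>a\<in>S. of_int (zorder f a) * (ln (norm (blaschke R a y)) - ln (norm (blaschke R a x))))"
        by (simp add: Bx_def By_def right_diff_distrib sum_subtractf)
      also have "\<dots> \<le> (\<Sum>a\<in>S. w a * (4 * square_weight (csqrt a) t + 1 / \<rho>))"
      proof (rule sum_mono)
        fix a assume aS: "a \<in> S"
        have aR: "norm a < R" using aS by (simp add: S_def)
        define \<alpha> where "\<alpha> = csqrt a"
        have \<alpha>: "a = \<alpha>\<^sup>2" by (simp add: \<alpha>_def)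
        have texc: "t \<notin> square_exceptions \<alpha>" using t aS by (auto simp: E'_def \<alpha>_def)
        then have texc': "t \<notin> square_exceptions (- \<alpha>)" by (simp add: square_exceptions_def)
        have sq': "\<bar>Re z\<bar> = t \<or> \<bar>Im z\<bar> = t" using sq by blast
        note b1 = square_weight_bound[OF texc t1(1) sq'] and b2 = square_weight_bound[OF texc' t1(1) sq']
        \<comment> \<open>In the variable \<open>z\<close> the step from \<open>x\<close> to
          \<open>y\<close> translates both linear factors by \<i>, so
          \<open>square_weight_bound\<close> applies to both square roots of
          \<open>a\<close>.\<close>
        have fx: "x - a = (z - \<alpha>) * (z - - \<alpha>)" by (simp add: x_def \<alpha> power2_eq_square algebra_simps)
        have fy: "y - a = (z - \<alpha> + \<i>) * (z - - \<alpha> + \<i>)" by (simp add: y_def \<alpha> power2_eq_square algebra_simps)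
        have "ln (norm (x - a)) = ln (norm (z - \<alpha>)) + ln (norm (z - - \<alpha>))"
          unfolding fx norm_mult using b1 b2 by (subst ln_mult) auto
        moreover have "ln (norm (y - a)) = ln (norm (z - \<alpha> + \<i>)) + ln (norm (z - - \<alpha> + \<i>))"
          unfolding fy norm_mult using b1 b2 by (subst ln_mult) auto
        ultimately have d1: "\<bar>ln (norm (y - a)) - ln (norm (x - a))\<bar> \<le> 4 * square_weight \<alpha> t"
          using add_diffs[OF b1(3) b2(3)[unfolded square_weight_minus]] by simp
        define q where "q = (\<lambda>x. (of_real R)\<^sup>2 - cnj a * x)"
        have q: "norm (q u) \<ge> R\<^sup>2 / 2" if "norm u \<le> R / 4" for u
        proof -
          have "R * norm u \<le> R * (R / 4)" using that Rpos by (intro mult_left_mono) auto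
          moreover have "R\<^sup>2 - R * norm u \<le> norm (q u)" unfolding q_def by (rule blaschke_denom_bounds[OF aR])
          moreover have "R * (R/4) \<le> R\<^sup>2 / 2" by (simp add: power2_eq_square)
          ultimately show ?thesis by simp
        qed
        have R2: "R\<^sup>2 / 2 > 0" using Rpos by simp
        \<comment> \<open>The denominators of the Blaschke factors stay of size R^2 and change by at
          most R * norm (y - x), so they need no averaging.\<close>
        have "\<bar>ln (norm (q x)) - ln (norm (q y))\<bar> \<le> \<bar>norm (q x) - norm (q y)\<bar> / (R\<^sup>2 / 2)"
          using q[OF nx] q[OF ny] R2 by (rule abs_ln_diff_le)
        also have "\<dots> \<le> norm (q x - q y) / (R\<^sup>2 / 2)"
          by (intro divide_right_mono norm_triangle_ineq3) simp
        also have "q x - q y = cnj a * (y - x)" by (simp add: q_def algebra_simps)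
        also have "norm (cnj a * (y - x)) / (R\<^sup>2 / 2) \<le> R * norm (y - x) / (R\<^sup>2 / 2)"
          unfolding norm_mult using aR by (intro divide_right_mono mult_right_mono) auto
        also have "\<dots> = 2 * norm (y - x) / R" using Rpos by (simp add: power2_eq_square)
        also have "\<dots> \<le> 4 * norm (y - x) / R" using Rpos by (intro divide_right_mono) auto
        also note small
        finally have d2: "\<bar>ln (norm (q x)) - ln (norm (q y))\<bar> \<le> 1 / \<rho>" .
        have bl: "ln (norm (blaschke R a u)) = ln R + ln (norm (u - a)) - ln (norm (q u))"
          if "u - a \<noteq> 0" "norm u \<le> R / 4" for u
        proof -
          have "q u \<noteq> 0" using q[OF that(2)] R2 by auto
          moreover have "norm (blaschke R a u) = R * norm (u - a) / norm (q u)"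
            using Rpos by (simp add: blaschke_def q_def norm_mult norm_divide)
          ultimately show ?thesis using Rpos that by (simp add: ln_div ln_mult)
        qed
        have nz: "x - a \<noteq> 0" "y - a \<noteq> 0" unfolding fx fy using b1 b2 by auto
        have "\<bar>ln (norm (blaschke R a y)) - ln (norm (blaschke R a x))\<bar> \<le> 4 * square_weight \<alpha> t + 1 / \<rho>"
          unfolding bl[OF nz(1) nx] bl[OF nz(2) ny] by (rule sub_diffs[OF d1 d2])
        then have "\<bar>of_int (zorder f a) * (ln (norm (blaschke R a y)) - ln (norm (blaschke R a x)))\<bar>
            \<le> w a * (4 * square_weight \<alpha> t + 1 / \<rho>)"
          unfolding abs_mult w_def by (intro mult_left_mono) auto
        then show "of_int (zorder f a) * (ln (norm (blaschke R a y)) - ln (norm (blaschke R a x)))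
            \<le> w a * (4 * square_weight (csqrt a) t + 1 / \<rho>)"
          unfolding \<alpha>_def by (rule abs_le_D1)
      qed
      also have "\<dots> = 4 * (\<Sum>a\<in>S. w a * square_weight (csqrt a) t) + W * (1 / \<rho>)"
        unfolding W_def sum_distrib_left sum_distrib_right sum.distrib[symmetric]
        by (intro sum.cong refl) (simp add: algebra_simps)
      also have "\<dots> \<le> 4 * ((W * J + 1) / \<rho>) + W * (1 / \<rho>)"
        using t(2) by (intro add_right_mono mult_left_mono) auto
      also have "\<dots> = (4 * (W * J + 1) + W) / \<rho>" by (simp add: add_divide_distrib)
      also have "\<dots> \<le> (4 * (P * J + 1) + P) / \<rho>"
        using WP J0 \<rho>3 by (intro divide_right_mono add_mono mult_left_mono mult_right_mono) auto
      finally show ?thesis .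
    qed
    moreover have "(2 * P + 4 * P * J + 4) / \<rho> = P / \<rho> + (4 * (P * J + 1) + P) / \<rho>"
      using \<rho>3 by (simp add: field_simps)
    ultimately have fin: "ln (norm (f y)) - ln (norm (f x)) \<le> (2 * P + 4 * P * J + 4) / \<rho>"
      by linarith
    \<comment> \<open>Since \<open>\<rho> \<ge> 3\<close>, the fourth power is at least 81. It
      absorbs the constants in ln R and \<open>J\<close> into multiples of ln \<rho>.\<close>
    have "65 \<le> \<rho> * \<rho> * \<rho> * \<rho>"
    proof -
      have "9 \<le> \<rho> * \<rho>" using \<rho>2 \<rho>3 by linarith
      then have "9 * 9 \<le> (\<rho> * \<rho>) * (\<rho> * \<rho>)" by (intro mult_mono) auto
      then show ?thesis by (simp add: mult.assoc)
    qed
    then have "ln 65 \<le> ln (\<rho> * \<rho> * \<rho> * \<rho>)" using \<rho>3 by (subst ln_le_cancel_iff) auto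
    also have "\<dots> = 4 * ln \<rho>" using \<rho>3 by (simp add: ln_mult)
    finally have l65: "ln 65 \<le> 4 * ln \<rho>" .
    have "ln R \<le> ln (65 * (\<rho> * \<rho>))" using R Rpos by (subst ln_le_cancel_iff) (auto simp: power2_eq_square)
    also have "\<dots> = ln 65 + 2 * ln \<rho>" using \<rho>3 by (simp add: ln_mult)
    finally have lR: "ln R \<le> 6 * ln \<rho>" using l65 by linarith
    have "1 + 12 * \<rho> \<le> \<rho> * \<rho> * \<rho> * \<rho>"
    proof -
      have "9 \<le> \<rho> * \<rho>" using \<rho>2 \<rho>3 by linarith
      then have "9 * (3 * \<rho>) \<le> (\<rho> * \<rho>) * (\<rho> * \<rho>)" using \<rho>2 \<rho>3 \<open>9 \<le> \<rho> * \<rho>\<close> by (intro mult_mono) auto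
      also have "\<dots> = \<rho> * \<rho> * \<rho> * \<rho>" by simp
      finally show ?thesis using \<rho>3 by linarith
    qed
    then have "ln (1 + 12 * \<rho>) \<le> ln (\<rho> * \<rho> * \<rho> * \<rho>)" using \<rho>3 by (subst ln_le_cancel_iff) auto
    also have "\<dots> = 4 * ln \<rho>" using \<rho>3 by (simp add: ln_mult)
    finally have J: "J \<le> 40 * ln \<rho>" using l by (simp add: J_def)
    have "R powr s \<le> (65 * (\<rho> * \<rho>)) powr s" using R Rpos s by (intro powr_mono2) (auto simp: power2_eq_square)
    also have "\<dots> = 65 powr s * \<rho> powr (2 * s)" using \<rho>3 by (simp add: powr_mult powr_add[symmetric])
    finally have "R powr s * ln R \<le> (65 powr s * \<rho> powr (2 * s)) * (6 * ln \<rho>)"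
      using lR RR0 R0 by (intro mult_mono) auto
    then have "P \<le> C * ((65 powr s * \<rho> powr (2 * s)) * (6 * ln \<rho>))"
      unfolding P_def using C by (intro mult_left_mono)
    \<comment> \<open>162 = 2 + 4 * 40. The product with the 6 from ln R is 972, rounded up to 1200
      below.\<close>
    moreover have "2 + 4 * J \<le> 162 * ln \<rho>" using J l by simp
    ultimately have "P * (2 + 4 * J) \<le> C * ((65 powr s * \<rho> powr (2 * s)) * (6 * ln \<rho>)) * (162 * ln \<rho>)"
      using C l J0 by (intro mult_mono) auto
    also have "\<dots> = 972 * (C * 65 powr s * (\<rho> powr (2 * s) * (ln \<rho>)\<^sup>2))" by (simp add: power2_eq_square)
    also have "\<dots> \<le> 1200 * (C * 65 powr s * (\<rho> powr (2 * s) * (ln \<rho>)\<^sup>2))"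
      using C by (intro mult_right_mono) auto
    finally have "2 * P + 4 * P * J \<le> 1200 * C * 65 powr s * (\<rho> powr (2 * s) * (ln \<rho>)\<^sup>2)"
      by (simp add: algebra_simps)
    moreover have "1 * 1 \<le> \<rho> powr (2 * s) * (ln \<rho>)\<^sup>2"
      using \<rho>3 s l by (intro mult_mono) (auto simp: ge_one_powr_ge_zero one_le_power)
    ultimately have "2 * P + 4 * P * J + 4 \<le> (1200 * C * 65 powr s + 4) * (\<rho> powr (2 * s) * (ln \<rho>)\<^sup>2)"
      by (simp add: algebra_simps)
    then have "(2 * P + 4 * P * J + 4) / \<rho> \<le> (1200 * C * 65 powr s + 4) * (\<rho> powr (2 * s) * (ln \<rho>)\<^sup>2) / \<rho>"
      using \<rho>3 by (intro divide_right_mono) auto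
    also have "\<dots> = (1200 * C * 65 powr s + 4) * (\<rho> powr (2 * s - 1) * (ln \<rho>)\<^sup>2)"
      using \<rho>3 by (simp add: powr_diff)
    finally show "ln (norm (f ((z + \<i>)\<^sup>2))) - ln (norm (f (z\<^sup>2)))
       \<le> (1200 * C * 65 powr s + 4) * (\<rho> powr (2 * s - 1) * (ln \<rho>)\<^sup>2)"
      using fin by (simp add: x_def y_def)
  qed
qed

end

subsection \<open>The difference equation\<close>

text \<open>Raising \<open>e\<close> by 1/2 and moving \<open>z\<close> by \<i>/2 turns e - \<i> * z
  into itself plus 1 and leaves e + \<i> * z fixed. The functional equation of \<open>Gamma\<close>
  therefore produces a rational multiplier.\<close>

lemma wilson_root_shift:
  assumes e: "\<And>e. e \<in> {a, b, c, d} \<Longrightarrow> e - \<i> * z \<notin> \<int>\<^sub>\<le>\<^sub>0"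
    and z: "2 * \<i> * z \<notin> \<int>"
  shows "wilson_\<mu>_root (a + 1/2) (b + 1/2) (c + 1/2) (d + 1/2) (z + \<i>/2)
    = wilson_\<mu>_root a b c d z * ((a - \<i> * z) * (b - \<i> * z) * (c - \<i> * z) * (d - \<i> * z))
        * (2 * \<i> * z - 1) / (- (2 * \<i> * z))"
proof -
  have G1: "Gamma (e + 1/2 - \<i> * (z + \<i>/2)) = (e - \<i> * z) * Gamma (e - \<i> * z)" if "e \<in> {a, b, c, d}" for e
  proof -
    have "e + 1/2 - \<i> * (z + \<i>/2) = (e - \<i> * z) + 1" by (simp add: algebra_simps)
    then show ?thesis by (simp only: Gamma_plus1[OF e[OF that]])
  qed
  have G2: "Gamma (e + 1/2 + \<i> * (z + \<i>/2)) = Gamma (e + \<i> * z)" for e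
  proof -
    have "e + 1/2 + \<i> * (z + \<i>/2) = e + \<i> * z" by (simp add: algebra_simps)
    then show ?thesis by (simp only:)
  qed
  have i1: "2 * \<i> * z - 1 \<notin> \<int>"
    using z Ints_add[OF _ Ints_1, of "2 * \<i> * z - 1"] by auto
  have i2: "- 2 * \<i> * z \<notin> \<int>"
    using z Ints_minus[of "- 2 * \<i> * z"] by auto
  have n1: "2 * \<i> * z - 1 \<notin> \<int>\<^sub>\<le>\<^sub>0" and n2: "- 2 * \<i> * z \<notin> \<int>\<^sub>\<le>\<^sub>0"
    using i1 i2 nonpos_Ints_subset_Ints by blast+
  have D1: "Gamma (2 * \<i> * z) = (2 * \<i> * z - 1) * Gamma (2 * \<i> * (z + \<i>/2))"
  proof -
    have "2 * \<i> * (z + \<i>/2) = 2 * \<i> * z - 1" by (simp add: algebra_simps)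
    then show ?thesis using Gamma_plus1[OF n1] by simp
  qed
  have D2: "Gamma (- 2 * \<i> * (z + \<i>/2)) = (- 2 * \<i> * z) * Gamma (- 2 * \<i> * z)"
  proof -
    have "- 2 * \<i> * (z + \<i>/2) = - 2 * \<i> * z + 1" by (simp add: algebra_simps)
    then show ?thesis using Gamma_plus1[OF n2] by simp
  qed
  have nz: "2 * \<i> * z - 1 \<noteq> 0" using i1 by auto
  \<comment> \<open>When \<open>Q\<close>, \<open>P\<close> or \<open>w\<close> is 0, both sides are
    0 by the convention for division, so only \<open>v\<close> must be nonzero.\<close>
  have alg: "(pa * ga * ha * ((pb * gb * hb) * ((pc * gc * hc) * ((pd * gd * hd) * 1)))) / (Q * (- w * P))
      = (ga * ha * ((gb * hb) * ((gc * hc) * ((gd * hd) * 1)))) / ((v * Q) * P) * (pa * pb * pc * pd) * v / (- w)"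
    if "v \<noteq> 0" for pa pb pc pd ga gb gc gd ha hb hc hd Q P v w :: complex
    using that by (cases "Q = 0"; cases "P = 0"; cases "w = 0") (simp_all add: field_simps)
  have "- 2 * \<i> * z = - (2 * \<i> * z)" by simp
  then show ?thesis
    unfolding wilson_\<mu>_root_def
    by (simp only: list.map prod_list.Cons prod_list.Nil G1 G2 D1 D2 insertI1 insertI2 insert_iff simp_thms)
      (rule alg[OF nz(1)])
qed

lemma wilson_root_nonzero:
  assumes "\<And>e. e \<in> {a, b, c, d} \<Longrightarrow> e - \<i> * z \<notin> \<int>\<^sub>\<le>\<^sub>0 \<and> e + \<i> * z \<notin> \<int>\<^sub>\<le>\<^sub>0" "2 * \<i> * z \<notin> \<int>"
  shows "wilson_\<mu>_root a b c d z \<noteq> 0"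
proof -
  have "- 2 * \<i> * z \<notin> \<int>"
    using assms(2) Ints_minus[of "- 2 * \<i> * z"] by auto
  then have "2 * \<i> * z \<notin> \<int>\<^sub>\<le>\<^sub>0" "- 2 * \<i> * z \<notin> \<int>\<^sub>\<le>\<^sub>0"
    using assms(2) nonpos_Ints_subset_Ints by blast+
  then show ?thesis
    unfolding wilson_\<mu>_root_def using assms(1) by (simp add: Gamma_eq_zero_iff)
qed

text \<open>The coefficient belonging to the neighbour (z + \<i>)^2; its value at \<open>- z\<close>
  belongs to (z - \<i>)^2. It behaves like z^2 / 4 at infinity.\<close>

definition wilson_coeff :: "complex \<Rightarrow> complex \<Rightarrow> complex \<Rightarrow> complex \<Rightarrow> complex \<Rightarrow> complex" where
  "wilson_coeff a b c d z = (a - \<i> * z) * (b - \<i> * z) * (c - \<i> * z) * (d - \<i> * z) / (4 * z\<^sup>2)"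

text \<open>All Gamma factors cancel by \<open>wilson_root_shift\<close>. The weight at the lower
  neighbour is obtained from the same lemma at \<open>- z\<close>, as the weight is even. The
  factors w - 1 and w + 1 cancel against the denominators of the inner difference quotients.\<close>

lemma wilson_L_eq:
  assumes e: "\<And>e. e \<in> {a, b, c, d} \<Longrightarrow> e - \<i> * z \<notin> \<int>\<^sub>\<le>\<^sub>0 \<and> e + \<i> * z \<notin> \<int>\<^sub>\<le>\<^sub>0"
    and z: "2 * \<i> * z \<notin> \<int>"
  shows "wilson_L a b c d f (z\<^sup>2) =
    wilson_coeff a b c d z * (f ((z + \<i>)\<^sup>2) - f (z\<^sup>2)) + wilson_coeff a b c d (- z) * (f ((z - \<i>)\<^sup>2) - f (z\<^sup>2))"
proof -
  define M where "M = wilson_\<mu>_root a b c d z"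
  have M: "M \<noteq> 0" unfolding M_def using e z by (rule wilson_root_nonzero)
  define w where "w = 2 * \<i> * z"
  have w: "w \<notin> \<int>" using z by (simp add: w_def)
  have wn: "w \<noteq> 0" "w - 1 \<noteq> 0" "w + 1 \<noteq> 0"
    using w by (auto simp: add_eq_0_iff2)
  have z0: "z \<noteq> 0" using wn by (simp add: w_def)
  have w2: "w * w = - (4 * z\<^sup>2)" by (simp add: w_def power2_eq_square)
  have sh: "2 * \<i> * (z + \<i>/2) = w - 1" "2 * \<i> * (z - \<i>/2) = w + 1"
    by (simp_all add: w_def algebra_simps)
  then have "z + \<i>/2 \<noteq> 0" "z - \<i>/2 \<noteq> 0" using wn(2,3) by (metis mult_zero_right)+
  then have zn: "(z + \<i>/2)\<^sup>2 \<noteq> 0" "(z - \<i>/2)\<^sup>2 \<noteq> 0" by simp_all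
  define mu where "mu = wilson_\<mu> (a + 1/2) (b + 1/2) (c + 1/2) (d + 1/2)"
  define Pm where "Pm = (a - \<i> * z) * (b - \<i> * z) * (c - \<i> * z) * (d - \<i> * z)"
  define Pp where "Pp = (a + \<i> * z) * (b + \<i> * z) * (c + \<i> * z) * (d + \<i> * z)"
  have mu1: "mu ((z + \<i>/2)\<^sup>2) = M * Pm * (w - 1) / (- w)"
    unfolding mu_def M_def Pm_def w_def using e z
    by (subst wilson_\<mu>_eq[OF refl], subst wilson_root_shift) auto
  have "(z - \<i>/2)\<^sup>2 = (- z + \<i>/2)\<^sup>2" by (simp add: power2_eq_square algebra_simps)
  moreover have "wilson_\<mu>_root a b c d (- z) = M" by (simp add: M_def wilson_\<mu>_root_def mult_ac)
  moreover have "2 * \<i> * - z \<notin> \<int>" using z Ints_minus[of "2 * \<i> * - z"] by auto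
  ultimately have mu2: "mu ((z - \<i>/2)\<^sup>2) = M * Pp * (- w - 1) / w"
    unfolding mu_def Pp_def w_def using e
    by (simp only:) (subst wilson_\<mu>_eq[OF refl], subst wilson_root_shift, auto)
  have D1: "wilson_D f ((z + \<i>/2)\<^sup>2) = (f ((z + \<i>)\<^sup>2) - f (z\<^sup>2)) / (w - 1)"
    unfolding wilson_D_eq[OF zn(1) refl] wilson_quot_def sh by (simp add: add.assoc)
  have D2: "wilson_D f ((z - \<i>/2)\<^sup>2) = (f (z\<^sup>2) - f ((z - \<i>)\<^sup>2)) / (w + 1)"
    unfolding wilson_D_eq[OF zn(2) refl] wilson_quot_def sh by (simp add: diff_diff_eq)
  have "wilson_L a b c d f (z\<^sup>2) = 1 / M * ((mu ((z + \<i>/2)\<^sup>2) * wilson_D f ((z + \<i>/2)\<^sup>2)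
      - mu ((z - \<i>/2)\<^sup>2) * wilson_D f ((z - \<i>/2)\<^sup>2)) / w)"
    unfolding wilson_L_def mu_def[symmetric] M_def using z0
    by (subst wilson_D_eq[of "z\<^sup>2" z]) (auto simp: wilson_quot_def w_def wilson_\<mu>_eq)
  also have "\<dots> = - (Pm * (f ((z + \<i>)\<^sup>2) - f (z\<^sup>2)) / (w * w)) - Pp * (f ((z - \<i>)\<^sup>2) - f (z\<^sup>2)) / (w * w)"
  proof -
    have X: "M * Pm * (w - 1) / (- w) * (F / (w - 1)) = - (M * (Pm * F / w))" for F
      using wn by (simp add: divide_simps)
    have Y: "M * Pp * (- w - 1) / w * (F / (w + 1)) = - (M * (Pp * F / w))" for F
    proof -
      have gen: "p * (- v) / w * (F / v) = - (p * F / w)" if "v \<noteq> 0" for p v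
        using that by simp
      have "- w - 1 = - (w + 1)" by simp
      then show ?thesis using gen[OF wn(3), of "M * Pp"] by (simp only:) simp
    qed
    show ?thesis unfolding mu1 mu2 D1 D2 X Y using M wn(1) by (simp add: divide_simps) (simp add: algebra_simps)
  qed
  also have "\<dots> = wilson_coeff a b c d z * (f ((z + \<i>)\<^sup>2) - f (z\<^sup>2)) + wilson_coeff a b c d (- z) * (f ((z - \<i>)\<^sup>2) - f (z\<^sup>2))"
    unfolding w2 wilson_coeff_def Pm_def Pp_def by simp
  finally show ?thesis .
qed

lemma norm_wilson_coeff_le:
  assumes "norm a \<le> \<rho>" "norm b \<le> \<rho>" "norm c \<le> \<rho>" "norm d \<le> \<rho>" "\<rho> \<le> norm z" "norm z \<le> 3 * \<rho>" "\<rho> > 0"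
  shows "norm (wilson_coeff a b c d z) \<le> 64 * \<rho>\<^sup>2"
proof -
  have 1: "norm (e - \<i> * z) \<le> 4 * \<rho>" if "norm e \<le> \<rho>" for e
    using norm_triangle_ineq4[of e "\<i> * z"] that assms by (simp add: norm_mult)
  have "norm (wilson_coeff a b c d z)
      = norm (a - \<i> * z) * norm (b - \<i> * z) * norm (c - \<i> * z) * norm (d - \<i> * z) / (4 * (norm z)\<^sup>2)"
    by (simp add: wilson_coeff_def norm_mult norm_divide norm_power)
  also have "\<dots> \<le> (4 * \<rho>) * (4 * \<rho>) * (4 * \<rho>) * (4 * \<rho>) / (4 * \<rho>\<^sup>2)"
    using assms 1 by (intro frac_le mult_mono power_mono mult_nonneg_nonneg mult_pos_pos) auto
  also have "\<dots> = 64 * \<rho>\<^sup>2" using assms by (simp add: power2_eq_square)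
  finally show ?thesis .
qed

section \<open>From the quotient estimate to the growth of the entire function\<close>

lemma countable_square_preimage:
  assumes "countable B" shows "countable {z. (z :: complex)\<^sup>2 \<in> B}"
proof (rule countable_subset)
  show "{z. z\<^sup>2 \<in> B} \<subseteq> csqrt ` B \<union> (\<lambda>x. - csqrt x) ` B"
  proof
    fix z assume z: "z \<in> {z. z\<^sup>2 \<in> B}"
    have "z = csqrt (z\<^sup>2) \<or> z = - csqrt (z\<^sup>2)" by (metis power2_csqrt power2_eq_iff)
    then show "z \<in> csqrt ` B \<union> (\<lambda>x. - csqrt x) ` B" using z by blast
  qed
qed (use assms in auto)

lemma countable_affine_preimage:
  assumes "countable B" "p \<noteq> 0" shows "countable {z. e + p * (z :: complex) \<in> B}"
proof (rule countable_subset)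
  show "{z. e + p * z \<in> B} \<subseteq> (\<lambda>x. (x - e) / p) ` B"
  proof
    fix z assume "z \<in> {z. e + p * z \<in> B}"
    then show "z \<in> (\<lambda>x. (x - e) / p) ` B" using assms by (intro image_eqI[of _ _ "e + p * z"]) auto
  qed
qed (use assms in auto)

lemma nev_T_entire_le:
  assumes hol: "\<phi> holomorphic_on UNIV" and B: "\<And>x. norm x = r \<Longrightarrow> norm (\<phi> x) \<le> exp H" and H: "H \<ge> 0" and r: "r \<ge> 0"
  shows "nev_T r \<phi> \<le> H"
proof -
  have "\<phi> analytic_on {z}" for z
    using hol by (meson UNIV_I analytic_at open_UNIV)
  then have np: "\<not> is_pole \<phi> z" for z using analytic_at_imp_no_pole by blast
  have N: "nev_N r \<phi> = 0" by (simp add: nev_N_def nev_n_def np)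
  have "integral {0..2*pi} (\<lambda>\<theta>. ln_plus (norm (\<phi> (of_real r * cis \<theta>)))) \<le> integral {0..2*pi} (\<lambda>\<theta>. H)"
  proof (rule integral_le)
    have "continuous_on {0..2*pi} (\<lambda>\<theta>. \<phi> (of_real r * cis \<theta>))"
      by (rule continuous_on_compose2[OF holomorphic_on_imp_continuous_on[OF hol]]) (auto intro!: continuous_intros)
    then show "(\<lambda>\<theta>. ln_plus (norm (\<phi> (of_real r * cis \<theta>)))) integrable_on {0..2*pi}"
      unfolding ln_plus_def
      by (intro integrable_continuous_real continuous_intros continuous_on_max) (auto simp: max_def)
    fix \<theta>
    have "max 1 (norm (\<phi> (of_real r * cis \<theta>))) \<le> exp H"
      using B[of "of_real r * cis \<theta>"] H r by (simp add: norm_mult)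
    then show "ln_plus (norm (\<phi> (of_real r * cis \<theta>))) \<le> H"
      unfolding ln_plus_def using ln_mono[of "max 1 (norm (\<phi> (of_real r * cis \<theta>)))" "exp H"] by simp
  qed auto
  then have "integral {0..2*pi} (\<lambda>\<theta>. ln_plus (norm (\<phi> (of_real r * cis \<theta>)))) \<le> 2 * pi * H" by simp
  then show ?thesis unfolding nev_T_def N nev_m_def by (simp add: divide_le_eq mult.commute)
qed

text \<open>The maximum principle is applied to the entire function mapping z to \<phi> (z^2). The
  square contains the disc of radius \<open>t\<close>, hence \<open>csqrt x\<close>.\<close>

lemma max_modulus_square:
  assumes hol: "\<phi> holomorphic_on UNIV" and t: "t > 0"
    and B: "\<And>z. \<bar>Re z\<bar> = t \<and> \<bar>Im z\<bar> \<le> t \<or> \<bar>Im z\<bar> = t \<and> \<bar>Re z\<bar> \<le> t \<Longrightarrow> norm (\<phi> (z\<^sup>2)) \<le> B"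
    and x: "norm x \<le> t\<^sup>2"
  shows "norm (\<phi> x) \<le> B"
proof -
  define S where "S = cbox (Complex (- t) (- t)) (Complex t t)"
  have hol2: "(\<lambda>z. \<phi> (z\<^sup>2)) holomorphic_on A" for A
  proof -
    have "(\<lambda>z. z\<^sup>2) holomorphic_on A" by (intro holomorphic_intros)
    from holomorphic_on_compose_gen[OF this hol] show ?thesis by (simp add: o_def)
  qed
  have "norm (csqrt x) \<le> t" using x t by (simp add: norm_csqrt real_le_lsqrt)
  then have "\<bar>Re (csqrt x)\<bar> \<le> t" "\<bar>Im (csqrt x)\<bar> \<le> t"
    by (rule order.trans[OF abs_Re_le_cmod] order.trans[OF abs_Im_le_cmod])+
  then have "csqrt x \<in> S"
    unfolding S_def in_cbox_complex_iff complex.sel abs_le_iff atLeastAtMost_iff by linarith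
  have front: "norm (\<phi> (z\<^sup>2)) \<le> B" if "z \<in> frontier S" for z
  proof (rule B)
    have "Re z \<in> {- t..t}" "Im z \<in> {- t..t}" "Re z \<notin> {- t<..<t} \<or> Im z \<notin> {- t<..<t}"
      using that unfolding S_def frontier_cbox Diff_iff in_cbox_complex_iff in_box_complex_iff complex.sel
      by blast+
    then show "\<bar>Re z\<bar> = t \<and> \<bar>Im z\<bar> \<le> t \<or> \<bar>Im z\<bar> = t \<and> \<bar>Re z\<bar> \<le> t"
      by auto
  qed
  have "bounded S" by (simp add: S_def)
  from maximum_modulus_frontier[OF hol2 holomorphic_on_imp_continuous_on[OF hol2] this front \<open>csqrt x \<in> S\<close>]
  show ?thesis by simp
qed

text \<open>The equation holds only off a sparse set and its rewritten form only off the exceptional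
  points of the weight. All these points form a countable set, which the half-side can avoid, so the
  bound on \<phi> holds on the entire boundary.\<close>

lemma (in nontrivial_meromorphic) wilson_eigen_growth:
  assumes hol: "\<phi> holomorphic_on UNIV"
    and eq: "\<forall>\<^sub>\<approx>x\<in>UNIV. wilson_L a b c d f x = \<phi> x * f x"
    and T: "\<forall>\<^sub>F r in at_top. nev_T r f \<le> r powr s" and s: "s \<ge> 0"
  obtains K \<rho>0 where "K \<ge> 0"
    "\<And>\<rho>. \<rho> \<ge> \<rho>0 \<Longrightarrow> nev_T (\<rho>\<^sup>2) \<phi> \<le> ln 256 + 2 * ln \<rho> + K * (\<rho> powr (2 * s - 1) * (ln \<rho>)\<^sup>2)"
proof -
  obtain C R0 where C: "C \<ge> 0" and R0: "R0 \<ge> 3" and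
    cnt: "\<And>R. R \<ge> R0 \<Longrightarrow> (\<Sum>a\<in>bad \<inter> cball 0 R. \<bar>real_of_int (zorder f a)\<bar>) \<le> C * (R powr s * ln R)" and
    int: "\<And>R. R \<ge> R0 \<Longrightarrow> sphere 0 R \<inter> bad = {} \<Longrightarrow>
      integral {0..2*pi} (\<lambda>\<theta>. \<bar>ln (norm (f (of_real R * cis \<theta>)))\<bar>) \<le> C * (R powr s * ln R)"
    by (rule growth[OF T s]) (rule that)
  define K where "K = 1200 * C * 65 powr s + 4"
  have K: "K \<ge> 0" using C by (simp add: K_def)
  define X where "X = {x. \<not> wilson_L a b c d f x = \<phi> x * f x}"
  have cX: "countable X"
    using sparse_imp_countable[of UNIV X] eq unfolding eventually_cosparse X_def by simp
  \<comment> \<open>Written in the form \<open>e + p * z\<close>, as is \<open>W2\<close> with its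
    summand 0, to match \<open>countable_affine_preimage\<close>.\<close>
  define N where "N e = {z. e + \<i> * z \<in> \<int>\<^sub>\<le>\<^sub>0} \<union> {z. e + (- \<i>) * z \<in> \<int>\<^sub>\<le>\<^sub>0}" for e
  define V where "V = {u. u\<^sup>2 \<in> bad}"
  define W1 where "W1 = {z. z\<^sup>2 \<in> bad \<union> X}"
  define W2 where "W2 = {z. 0 + (2 * \<i>) * z \<in> \<int>}"
  define W where "W = W1 \<union> W2 \<union> (\<lambda>u. u - \<i>) ` V \<union> (\<lambda>u. u + \<i>) ` V \<union> N a \<union> N b \<union> N c \<union> N d"
  have cI: "countable (\<int> :: complex set)" by (simp add: Ints_def)
  then have cN: "countable (\<int>\<^sub>\<le>\<^sub>0 :: complex set)"
    by (rule countable_subset[OF nonpos_Ints_subset_Ints])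
  have cW: "countable W"
    unfolding W_def W1_def W2_def N_def V_def
    by (intro countable_Un countable_image countable_square_preimage countable_affine_preimage
        cX countable_bad cI cN) auto
  \<comment> \<open>A boundary point of the square of half-side \<open>t\<close> has
    \<open>\<bar>Re z\<bar> = t\<close> or \<open>\<bar>Im z\<bar> = t\<close>, so a half-side
    outside \<open>E\<close> keeps the whole boundary off \<open>W\<close>.\<close>
  define E where "E = (\<lambda>z. \<bar>Re z\<bar>) ` W \<union> (\<lambda>z. \<bar>Im z\<bar>) ` W"
  have cE: "countable E" unfolding E_def using cW by auto
  define \<rho>0 where "\<rho>0 = max R0 (norm a + norm b + norm c + norm d)"
  show ?thesis
  proof (rule that[OF K])
    fix \<rho> assume \<rho>: "\<rho> \<ge> \<rho>0"
    define D where "D = K * (\<rho> powr (2 * s - 1) * (ln \<rho>)\<^sup>2)"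
    have D: "D \<ge> 0" using K by (simp add: D_def)
    have \<rho>R: "\<rho> \<ge> R0" "\<rho> \<ge> 3" using \<rho> R0 by (auto simp: \<rho>0_def)
    have "norm a + norm b + norm c + norm d \<le> \<rho>" using \<rho> by (simp add: \<rho>0_def)
    then have na: "norm a \<le> \<rho>" "norm b \<le> \<rho>" "norm c \<le> \<rho>" "norm d \<le> \<rho>"
      using norm_ge_zero[of a] norm_ge_zero[of b] norm_ge_zero[of c] norm_ge_zero[of d] by linarith+
    have "\<exists>t\<in>{\<rho>..2*\<rho>} - E. \<forall>z. (\<bar>Re z\<bar> = t \<and> \<bar>Im z\<bar> \<le> t \<or> \<bar>Im z\<bar> = t \<and> \<bar>Re z\<bar> \<le> t) \<longrightarrow>
        z\<^sup>2 \<notin> bad \<longrightarrow> (z + \<i>)\<^sup>2 \<notin> bad \<longrightarrow> ln (norm (f ((z + \<i>)\<^sup>2))) - ln (norm (f (z\<^sup>2))) \<le> D"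
      unfolding D_def K_def by (rule shift_bound_on_square[OF R0 C cnt int \<rho>R(1) cE s])
    then obtain t where t: "t \<in> {\<rho>..2*\<rho>} - E" and
      tb: "\<And>z. \<bar>Re z\<bar> = t \<and> \<bar>Im z\<bar> \<le> t \<or> \<bar>Im z\<bar> = t \<and> \<bar>Re z\<bar> \<le> t \<Longrightarrow>
        z\<^sup>2 \<notin> bad \<Longrightarrow> (z + \<i>)\<^sup>2 \<notin> bad \<Longrightarrow> ln (norm (f ((z + \<i>)\<^sup>2))) - ln (norm (f (z\<^sup>2))) \<le> D"
      by blast
    have t0: "t > 0" "\<rho> \<le> t" "t \<le> 2 * \<rho>" using t \<rho>R by auto
    \<comment> \<open>256 = 2 * 64 * 2: two neighbours, coefficients of size at most 64 * \<rho>^2,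
      and quotients minus 1 of size at most 2 * exp D.\<close>
    have bound: "norm (\<phi> (z\<^sup>2)) \<le> 256 * \<rho>\<^sup>2 * exp D"
      if sq: "\<bar>Re z\<bar> = t \<and> \<bar>Im z\<bar> \<le> t \<or> \<bar>Im z\<bar> = t \<and> \<bar>Re z\<bar> \<le> t" for z
    proof -
      have zW: "z \<notin> W"
      proof
        assume "z \<in> W"
        then have "\<bar>Re z\<bar> \<in> E" "\<bar>Im z\<bar> \<in> E" unfolding E_def by blast+
        then have "t \<in> E" using sq by metis
        then show False using t by blast
      qed
      then have "z \<notin> W1" "z \<notin> W2" and zV: "z \<notin> (\<lambda>u. u - \<i>) ` V" "z \<notin> (\<lambda>u. u + \<i>) ` V"
        and zN: "z \<notin> N a" "z \<notin> N b" "z \<notin> N c" "z \<notin> N d"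
        unfolding W_def by blast+
      then have z1: "z\<^sup>2 \<notin> bad" "z\<^sup>2 \<notin> X" and z4: "2 * \<i> * z \<notin> \<int>"
        unfolding W1_def W2_def mem_Collect_eq Un_iff add_0 by blast+
      have "z + \<i> \<notin> V" using zV(1) image_eqI[of z "\<lambda>u. u - \<i>" "z + \<i>" V] by simp blast
      moreover have "z - \<i> \<notin> V" using zV(2) image_eqI[of z "\<lambda>u. u + \<i>" "z - \<i>" V] by simp blast
      ultimately have z2: "(z + \<i>)\<^sup>2 \<notin> bad" and z3: "(z - \<i>)\<^sup>2 \<notin> bad" by (simp_all add: V_def)
      have "z \<notin> N e" if "e \<in> {a, b, c, d}" for e using that zN by blast
      then have e: "e - \<i> * z \<notin> \<int>\<^sub>\<le>\<^sub>0 \<and> e + \<i> * z \<notin> \<int>\<^sub>\<le>\<^sub>0" if "e \<in> {a, b, c, d}" for e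
        using that unfolding N_def mem_Collect_eq Un_iff diff_conv_add_uminus mult_minus_left by blast
      have m: "(- z + \<i>)\<^sup>2 = (z - \<i>)\<^sup>2" by (simp add: power2_eq_square algebra_simps)
      define F where "F = f (z\<^sup>2)"
      have F: "F \<noteq> 0" using z1 by (simp add: F_def bad_def)
      have r: "norm (f y / F - 1) \<le> 2 * exp D" if y: "y \<notin> bad" "ln (norm (f y)) - ln (norm F) \<le> D" for y
      proof -
        have fy: "f y \<noteq> 0" using y by (simp add: bad_def)
        have "ln (norm (f y / F)) \<le> D" using y F fy by (simp add: norm_divide ln_div)
        then have "exp (ln (norm (f y / F))) \<le> exp D" by simp
        then have "norm (f y / F) \<le> exp D" using F fy by (subst (asm) exp_ln) auto
        moreover have "norm (f y / F - 1) \<le> norm (f y / F) + 1" using norm_triangle_ineq4[of "f y / F" 1] by simp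
        moreover have "1 \<le> exp D" using D by simp
        ultimately show ?thesis by linarith
      qed
      have r1: "norm (f ((z + \<i>)\<^sup>2) / F - 1) \<le> 2 * exp D"
        unfolding F_def using r[OF z2] tb[OF sq z1(1) z2] by (simp add: F_def)
      \<comment> \<open>The estimate is used at \<open>- z\<close>, which lies on the same
        boundary.\<close>
      have r2: "norm (f ((z - \<i>)\<^sup>2) / F - 1) \<le> 2 * exp D"
        using r[OF z3] tb[of "- z"] sq z1(1) z3 unfolding m by (simp add: F_def)
      have "\<bar>Re z\<bar> \<le> \<bar>t\<bar>" "\<bar>Im z\<bar> \<le> \<bar>t\<bar>" using sq t0 by auto
      then have "(norm z)\<^sup>2 \<le> t\<^sup>2 + t\<^sup>2"
        unfolding cmod_power2 by (intro add_mono) (simp_all only: abs_le_square_iff)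
      also have "\<dots> \<le> 2 * (2 * \<rho>)\<^sup>2" using t0 power_mono[of t "2 * \<rho>" 2] by simp
      also have "\<dots> \<le> (3 * \<rho>)\<^sup>2" by (simp add: power2_eq_square)
      finally have nz: "norm z \<le> 3 * \<rho>" using \<rho>R by (intro power2_le_imp_le[of "norm z" "3 * \<rho>"]) auto
      have "t \<le> norm z" using sq abs_Re_le_cmod[of z] abs_Im_le_cmod[of z] by metis
      then have nz': "\<rho> \<le> norm z" using t0 by simp
      have c1: "norm (wilson_coeff a b c d z) \<le> 64 * \<rho>\<^sup>2"
        using na nz nz' \<rho>R by (intro norm_wilson_coeff_le) auto
      have c2: "norm (wilson_coeff a b c d (- z)) \<le> 64 * \<rho>\<^sup>2"
        using na nz nz' \<rho>R by (intro norm_wilson_coeff_le) auto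
      have key: "norm x \<le> 256 * \<rho>\<^sup>2 * exp D"
        if x: "x * F = p * (u - F) + q * (v - F)"
          and p: "norm p \<le> 64 * \<rho>\<^sup>2" and q: "norm q \<le> 64 * \<rho>\<^sup>2"
          and u: "norm (u / F - 1) \<le> 2 * exp D" and v: "norm (v / F - 1) \<le> 2 * exp D"
        for x p q u v
      proof -
        have "x = (p * (u - F) + q * (v - F)) / F" using x F by (simp add: eq_divide_eq)
        also have "\<dots> = p * (u / F - 1) + q * (v / F - 1)" using F by (simp add: field_simps)
        finally have "norm x \<le> norm p * norm (u / F - 1) + norm q * norm (v / F - 1)"
          using norm_triangle_ineq[of "p * (u / F - 1)" "q * (v / F - 1)"] by (simp add: norm_mult)
        also have "\<dots> \<le> (64 * \<rho>\<^sup>2) * (2 * exp D) + (64 * \<rho>\<^sup>2) * (2 * exp D)"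
          by (rule add_mono[OF mult_mono[OF p u] mult_mono[OF q v]]) simp_all
        finally show ?thesis by (simp add: mult_ac)
      qed
      have "\<phi> (z\<^sup>2) * F = wilson_coeff a b c d z * (f ((z + \<i>)\<^sup>2) - F) + wilson_coeff a b c d (- z) * (f ((z - \<i>)\<^sup>2) - F)"
        using wilson_L_eq[OF e z4, where f = f] z1(2) unfolding X_def F_def by simp
      then show ?thesis by (rule key[OF _ c1 c2 r1 r2])
    qed
    have ex: "exp (ln 256 + 2 * ln \<rho> + D) = 256 * \<rho>\<^sup>2 * exp D"
    proof -
      have "exp (2 * ln \<rho>) = \<rho>\<^sup>2" using \<rho>R by (simp add: exp_double)
      then show ?thesis by (simp add: exp_add)
    qed
    show "nev_T (\<rho>\<^sup>2) \<phi> \<le> ln 256 + 2 * ln \<rho> + K * (\<rho> powr (2 * s - 1) * (ln \<rho>)\<^sup>2)"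
    proof (rule nev_T_entire_le[OF hol])
      show "0 \<le> ln 256 + 2 * ln \<rho> + K * (\<rho> powr (2 * s - 1) * (ln \<rho>)\<^sup>2)"
        unfolding D_def[symmetric] using \<rho>R D by simp
      fix x :: complex assume "norm x = \<rho>\<^sup>2"
      then have "norm x \<le> t\<^sup>2" using t0 \<rho>R by (simp add: power_mono)
      then have "norm (\<phi> x) \<le> 256 * \<rho>\<^sup>2 * exp D"
        by (rule max_modulus_square[OF hol t0(1), rotated]) (rule bound)
      then show "norm (\<phi> x) \<le> exp (ln 256 + 2 * ln \<rho> + K * (\<rho> powr (2 * s - 1) * (ln \<rho>)\<^sup>2))"
        unfolding D_def[symmetric] ex .
    qed auto
  qed
qed

theorem theorem6p2:
  fixes a b c d :: complex and \<phi> f :: "complex \<Rightarrow> complex"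
  assumes "\<phi> holomorphic_on UNIV"
    and "mero_order \<phi> > 0"
    and "f meromorphic_on UNIV"
    and "\<not> (\<forall>\<^sub>\<approx>x\<in>UNIV. f x = 0)"
    and "\<forall>\<^sub>\<approx>x\<in>UNIV. wilson_L a b c d f x = \<phi> x * f x"
  shows "mero_order f \<ge> mero_order \<phi> + ereal (1/2)"
proof (rule ccontr)
  assume "\<not> mero_order f \<ge> mero_order \<phi> + ereal (1/2)"
  then obtain s where s: "mero_order f < ereal s" "ereal s < mero_order \<phi> + ereal (1/2)"
    using ereal_dense2 not_le by metis
  have "\<forall>\<^sub>\<approx>x\<in>UNIV. f x \<noteq> 0"
    using meromorphic_imp_constant_or_avoid[OF assms(3), of 0] assms(4) by auto
  then interpret nontrivial_meromorphic f
    using assms(3) by unfold_locales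
  have ev: "\<forall>\<^sub>F r in at_top. ln_plus (nev_T r f) / ln r < s"
    using Limsup_lessD[OF s(1)[unfolded mero_order_def]] by simp
  have T: "\<forall>\<^sub>F r in at_top. nev_T r f \<le> r powr s"
    using ev eventually_ge_at_top[of 3]
  proof eventually_elim
    case (elim r)
    have l: "ln r > 0" using elim by simp
    then have "ln (max 1 (nev_T r f)) < s * ln r"
      using elim by (simp add: ln_plus_def divide_less_eq)
    then have "max 1 (nev_T r f) < exp (s * ln r)"
      by (subst (asm) exp_less_cancel_iff[symmetric]) simp
    then show ?case using elim by (simp add: powr_def)
  qed
  have "\<exists>r::real\<ge>3. ln_plus (nev_T r f) / ln r < s"
    using eventually_happens'[OF _ eventually_conj[OF ev eventually_ge_at_top[of 3]]] by auto
  then obtain r :: real where "r \<ge> 3" "ln_plus (nev_T r f) / ln r < s" by blast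
  moreover have "ln_plus (nev_T r f) / ln r \<ge> 0"
    using \<open>r \<ge> 3\<close> by (intro divide_nonneg_nonneg) (auto simp: ln_plus_def)
  ultimately have s0: "s \<ge> 0" by linarith
  obtain K \<rho>0 where K: "K \<ge> 0" and
    K\<rho>: "\<And>\<rho>. \<rho> \<ge> \<rho>0 \<Longrightarrow> nev_T (\<rho>\<^sup>2) \<phi> \<le> ln 256 + 2 * ln \<rho> + K * (\<rho> powr (2 * s - 1) * (ln \<rho>)\<^sup>2)"
    by (rule wilson_eigen_growth[OF assms(1,5) T s0]) (rule that)
  \<comment> \<open>The maximum with 0 accounts for the polynomial factor from the coefficients.
    Positivity of the order of \<phi> is what keeps \<sigma> below it.\<close>
  define \<sigma> where "\<sigma> = max 0 (s - 1/2)"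
  have "ereal (s - 1/2) < mero_order \<phi>"
    using s(2) by (cases "mero_order \<phi>") (auto simp: field_simps)
  then have "ereal \<sigma> < mero_order \<phi>" using assms(2) by (simp add: \<sigma>_def max_def zero_ereal_def)
  then obtain \<tau> where \<tau>: "ereal \<sigma> < ereal \<tau>" "ereal \<tau> < mero_order \<phi>"
    using ereal_dense2 by metis
  define \<delta> where "\<delta> = \<tau> - \<sigma>"
  have \<delta>: "\<delta> > 0" using \<tau>(1) by (simp add: \<delta>_def)
  have \<sigma>0: "\<sigma> \<ge> 0" by (simp add: \<sigma>_def)
  \<comment> \<open>The gap between \<sigma> and \<tau> absorbs all logarithmic factors.\<close>
  have "\<forall>\<^sub>F r in at_top. ln 256 + ln r + K * (ln r)\<^sup>2 \<le> r powr \<delta>"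
    using \<delta> by real_asymp
  then have "\<forall>\<^sub>F r in at_top. ereal (ln_plus (nev_T r \<phi>) / ln r) \<le> ereal \<tau>"
    using eventually_ge_at_top[of "max 3 (\<rho>0\<^sup>2)"]
  proof eventually_elim
    case (elim r)
    have r: "r \<ge> 3" "\<rho>0\<^sup>2 \<le> r" using elim by auto
    have l: "ln r \<ge> 1" using ln_ge_1[OF r(1)] .
    have rr: "sqrt r \<ge> \<rho>0" using r(2) real_le_rsqrt by blast
    have ls: "ln (sqrt r) = ln r / 2" using r by (simp add: ln_sqrt)
    have s1: "sqrt r \<ge> 1" using r by simp
    \<comment> \<open>With \<rho> = sqrt r the exponent 2 * s - 1 becomes s - 1/2 in terms of
      \<open>r\<close>.\<close>
    have "nev_T r \<phi> \<le> ln 256 + ln r + K * (sqrt r powr (2 * s - 1) * (ln r / 2)\<^sup>2)"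
      using K\<rho>[OF rr] r by (simp add: ls)
    also have "\<dots> \<le> ln 256 + ln r + K * (r powr \<sigma> * (ln r)\<^sup>2)"
    proof (intro add_left_mono mult_left_mono mult_mono K)
      have "sqrt r powr (2 * s - 1) \<le> sqrt r powr (2 * \<sigma>)"
        using s1 by (intro powr_mono) (auto simp: \<sigma>_def max_def)
      also have "\<dots> = r powr \<sigma>" using r by (simp add: powr_half_sqrt[symmetric] powr_powr)
      finally show "sqrt r powr (2 * s - 1) \<le> r powr \<sigma>" .
      show "(ln r / 2)\<^sup>2 \<le> (ln r)\<^sup>2" using l by (intro power_mono) auto
    qed auto
    also have "\<dots> \<le> r powr \<sigma> * (ln 256 + ln r + K * (ln r)\<^sup>2)"
    proof -
      have "1 \<le> r powr \<sigma>" using r \<sigma>0 by (simp add: ge_one_powr_ge_zero)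
      then have "1 * (ln 256 + ln r) \<le> r powr \<sigma> * (ln 256 + ln r)" using l by (intro mult_right_mono) auto
      then show ?thesis by (simp add: algebra_simps)
    qed
    also have "\<dots> \<le> r powr \<sigma> * r powr \<delta>" using elim by (intro mult_left_mono) auto
    also have "\<dots> = r powr \<tau>" by (simp add: powr_add[symmetric] \<delta>_def)
    finally have "nev_T r \<phi> \<le> r powr \<tau>" .
    moreover have "1 \<le> r powr \<tau>" using r \<sigma>0 \<tau> by (intro ge_one_powr_ge_zero) auto
    ultimately have "ln (max 1 (nev_T r \<phi>)) \<le> ln (r powr \<tau>)"
      using r by (subst ln_le_cancel_iff) auto
    then show ?case using l r by (simp add: ln_plus_def ln_powr divide_le_eq)
  qed
  then have "mero_order \<phi> \<le> ereal \<tau>" unfolding mero_order_def by (rule Limsup_bounded)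
  then show False using \<tau>(2) by simp
qed

end
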